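(* For each fixed $k\ge1$ and each $T<\infty$, $\sup_{t\in[0,T]}\left|\, e(G_k(t))/n-\tfrac12\int_0^t\rho_{k-1}(s)^2\,ds\,\right|\to0$ in probability as $n\to\infty$, where $e(G)$ denotes the number of edges of $G$.
   Context: Model: vertex set $[n]$. For each unordered pair $\{i,j\}$ of distinct vertices, edges between $i$ and $j$ arrive at the points of a Poisson process of rate $1/n$ on $(0,\infty)$, independently over pairs. $G_1(t)$ is the multigraph of all edges arrived by time $t$. Recursively: $F_k(t)$ is the subgraph of $G_k(t)$ of those edges which, at their arrival time $s\le t$, joined two different components of $G_k(s)$; $G_{k+1}(t):=G_k(t)\setminus F_k(t)$. For a graph $G$, $C_1(G)$ is the number of vertices in its largest component. For each $k\ge1$, $\rho_k:[0,\infty)\to[0,1]$ denotes the continuous function such that $C_1(G_k(t))/n\to\rho_k(t)$ in probability, uniformly in $t\ge0$ (its existence is a result of the same paper); and $\rho_0(t):=1$ for all $t$. *)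

theory Defs
  imports "HOL-Probability.Probability"
begin

text \<open>Vertices are 0..n-1. Unordered pairs of distinct vertices are encoded as (i,j) with i<j<n.
  An edge of the multigraph is ((i,j),m): the m-th arrival (m = 0,1,2,...) on pair (i,j).\<close>

type_synonym edge = "(nat \<times> nat) \<times> nat"

definition vpairs :: "nat \<Rightarrow> (nat \<times> nat) set" where
  "vpairs n = {(i, j). i < j \<and> j < n}"

definition all_edges :: "nat \<Rightarrow> edge set" where
  "all_edges n = {(p, m). p \<in> vpairs n}"

definition arrival :: "(nat \<Rightarrow> nat \<times> nat \<Rightarrow> nat \<Rightarrow> 'a \<Rightarrow> real) \<Rightarrow> nat \<Rightarrow> 'a \<Rightarrow> edge \<Rightarrow> real" where
  "arrival X n \<omega> e = (\<Sum>l\<le>snd e. X n (fst e) l \<omega>)"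

definition adj :: "edge set \<Rightarrow> nat \<Rightarrow> nat \<Rightarrow> bool" where
  "adj E u v \<longleftrightarrow> (\<exists>m. ((u, v), m) \<in> E \<or> ((v, u), m) \<in> E)"

definition connected_in :: "edge set \<Rightarrow> nat \<Rightarrow> nat \<Rightarrow> bool" where
  "connected_in E u v \<longleftrightarrow> (adj E)\<^sup>*\<^sup>* u v"

text \<open>survives n a k e: edge e belongs to G_(k+1) (over all time).  An edge of G_k belongs to
  F_k iff at its arrival time its endpoints were already in different components of the
  edges of G_k that arrived strictly earlier; G_(k+1) = G_k minus F_k.\<close>
primrec survives :: "nat \<Rightarrow> (edge \<Rightarrow> real) \<Rightarrow> nat \<Rightarrow> edge \<Rightarrow> bool" where
  "survives n a 0 e = (e \<in> all_edges n)"
| "survives n a (Suc k) e = (survives n a k e \<and>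
     connected_in {e'. survives n a k e' \<and> a e' < a e} (fst (fst e)) (snd (fst e)))"

definition Gedges :: "nat \<Rightarrow> (edge \<Rightarrow> real) \<Rightarrow> nat \<Rightarrow> real \<Rightarrow> edge set" where
  "Gedges n a k t = {e. survives n a (k - 1) e \<and> a e \<le> t}"

definition C1 :: "nat \<Rightarrow> edge set \<Rightarrow> nat" where
  "C1 n E = Max ((\<lambda>v. card {u. u < n \<and> connected_in E v u}) ` {..<n})"

text \<open>sup over t in I of D n \<omega> t tends to 0 in probability (stated with measurable
  covering events, so that it does not depend on measurability of the bad event).\<close>
definition sup_to_zero_in_prob ::
  "(nat \<Rightarrow> 'a measure) \<Rightarrow> real set \<Rightarrow> (nat \<Rightarrow> 'a \<Rightarrow> real \<Rightarrow> real) \<Rightarrow> bool" where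
  "sup_to_zero_in_prob M I D \<longleftrightarrow>
     (\<forall>\<epsilon>>0. \<exists>A. (\<forall>n. A n \<in> sets (M n)) \<and>
        (\<forall>n. {\<omega> \<in> space (M n). \<exists>t\<in>I. D n \<omega> t > \<epsilon>} \<subseteq> A n) \<and>
        (\<lambda>n. measure (M n) (A n)) \<longlonglongrightarrow> 0)"

end

theory Submission
  imports Defs
begin

text \<open>
An edge arriving at time \<open>s\<close> belongs to \<open>G\<^sub>k\<close> iff its endpoints are already connected in
\<open>G\<^bsub>k-1\<^esub>(s-)\<close>, so edges enter \<open>G\<^sub>k\<close> at rate \<open>1/n\<close> times the number of pairs connected in
\<open>G\<^bsub>k-1\<^esub>(s)\<close>.

Concentration around this compensator needs only independence over pairs. At most \<open>O(1)\<close> pairs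
have two arrivals in bounded time, so only the first arrival \<open>x\<^sub>p\<close> of each pair \<open>p\<close> matters.
Let \<open>D\<^sub>p\<close> be the indicator that this arrival is counted minus its mean given all other clocks. If \<open>D\<^sub>p\<^sup>q\<close> denotes
\<open>D\<^sub>p\<close> with \<open>q\<close> deleted, then \<open>E D\<^sub>p D\<^sub>q = E (D\<^sub>p - D\<^sub>p\<^sup>q) (D\<^sub>q - D\<^sub>q\<^sup>p)\<close>, and the main part of this product vanishes:
\<open>q\<close> can influence the indicator of \<open>p\<close> only if \<open>x\<^sub>q < x\<^sub>p\<close>, and conversely. Hence the variance of the sum is \<open>O(n)\<close>.

The same estimate, applied to the pairs between two given components of linear size, shows that such
components of \<open>G\<^bsub>k-1\<^esub>\<close> merge within an arbitrarily short time, one level after the other. As the largest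
component has a continuous limit \<open>\<rho>\<close>, there is thus only one of linear size, and the number of connected pairs
is \<open>\<rho>\<^sup>2 n\<^sup>2 / 2 + o(n\<^sup>2)\<close>. Monotonicity in \<open>t\<close> upgrades pointwise to uniform convergence.
\<close>

section \<open>Levels of the multigraph\<close>

text \<open>The conditional mean used here is not a martingale compensator: it averages one clock
  while all others, future ones included, are frozen. It stays computable because, for an arrival in
  a short interval, \<open>survives\<close> is squeezed between being joined at the left end and at
  the right end, and neither condition sees the pair's own clock if that clock is beyond the
  horizon. Lower and upper Riemann sums over a fixed grid then suffice.

  In the covariance identity the cross terms vanish because deleting \<open>p\<close> turns the
  factor of \<open>q\<close> into a function of the other clocks, while \<open>D p\<close> has mean
  zero in the clock of \<open>p\<close>. What remains needs both clocks below the horizon, an event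
  of probability O(1/n^2), and carries a further factor O(1/n). With O(n^4) couples of pairs this
  gives O(n), whereas Chebyshev at scale n needs only o(n^2).

  The clocks of the theorem live on arbitrary probability spaces and are positive only almost
  surely. The estimates are therefore made on the canonical product space and pulled back together
  with their measurable covering events.\<close>

lemma adj_mono: "E \<subseteq> E' \<Longrightarrow> adj E u v \<Longrightarrow> adj E' u v"
  unfolding adj_def by blast

lemma connected_in_mono: "E \<subseteq> E' \<Longrightarrow> connected_in E u v \<Longrightarrow> connected_in E' u v"
  unfolding connected_in_def using rtranclp_mono[of "adj E" "adj E'"] adj_mono by blast

lemma connected_in_refl: "connected_in E u u"
  unfolding connected_in_def by simp

lemma connected_in_trans: "connected_in E u v \<Longrightarrow> connected_in E v w \<Longrightarrow> connected_in E u w"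
  unfolding connected_in_def by (rule rtranclp_trans)

lemma connected_in_sym: "connected_in E u v \<Longrightarrow> connected_in E v u"
proof -
  have "symp (adj E)" unfolding symp_def adj_def by blast
  then have "symp (adj E)\<^sup>*\<^sup>*" by (rule symp_rtranclp)
  then show "connected_in E u v \<Longrightarrow> connected_in E v u"
    unfolding connected_in_def by (rule sympD)
qed

lemma connected_in_transfer:
  assumes "connected_in E u x" "connected_in E v y"
  shows "connected_in E u v \<longleftrightarrow> connected_in E x y"
proof
  assume "connected_in E u v"
  from connected_in_trans[OF connected_in_sym[OF assms(1)] connected_in_trans[OF this assms(2)]]
  show "connected_in E x y" .
next
  assume "connected_in E x y"
  from connected_in_trans[OF assms(1) connected_in_trans[OF this connected_in_sym[OF assms(2)]]]
  show "connected_in E u v" .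
qed

lemma connected_in_edge: "e \<in> E \<Longrightarrow> connected_in E (fst (fst e)) (snd (fst e))"
  unfolding connected_in_def adj_def by (rule r_into_rtranclp) (metis prod.collapse)

lemma survives_all_edges: "survives n a k e \<Longrightarrow> e \<in> all_edges n"
  by (induction k) auto

lemma survives_antimono: "survives n a k e \<Longrightarrow> j \<le> k \<Longrightarrow> survives n a j e"
proof (induction k)
  case (Suc k)
  then show ?case by (cases "j = Suc k") auto
qed auto

text \<open>Level 0 declares every pair joined, matching \<rho>_0 = 1. Without the clause
  \<open>k = 0\<close> the truncated \<open>k - 1\<close> would silently turn level 0 into level
  1.\<close>

definition joined_before :: "nat \<Rightarrow> (edge \<Rightarrow> real) \<Rightarrow> nat \<Rightarrow> real \<Rightarrow> nat \<times> nat \<Rightarrow> bool" where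
  "joined_before n a k b p \<longleftrightarrow>
     k = 0 \<or> connected_in {e. survives n a (k - 1) e \<and> a e < b} (fst p) (snd p)"

definition joined_at :: "nat \<Rightarrow> (edge \<Rightarrow> real) \<Rightarrow> nat \<Rightarrow> real \<Rightarrow> nat \<times> nat \<Rightarrow> bool" where
  "joined_at n a k s p \<longleftrightarrow> k = 0 \<or> connected_in (Gedges n a k s) (fst p) (snd p)"

text \<open>The edge sets of the levels are nested, so connectivity in one level implies it in every
  lower one, and the conditions accumulated by the recursion collapse to the last.\<close>

lemma survives_iff:
  "survives n a k e \<longleftrightarrow> e \<in> all_edges n \<and> joined_before n a k (a e) (fst e)"
proof (induction k)
  case 0
  then show ?case by (simp add: joined_before_def)
next
  case (Suc k)
  have "joined_before n a k (a e) (fst e)"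
    if *: "connected_in {e'. survives n a k e' \<and> a e' < a e} (fst (fst e)) (snd (fst e))"
  proof (cases k)
    case (Suc l)
    have "{e'. survives n a k e' \<and> a e' < a e} \<subseteq> {e'. survives n a l e' \<and> a e' < a e}"
      using Suc by auto
    from connected_in_mono[OF this *] Suc show ?thesis
      by (simp add: joined_before_def)
  qed (simp add: joined_before_def)
  with Suc show ?case by (auto simp: joined_before_def)
qed

lemma Gedges_iff: "e \<in> Gedges n a k t \<longleftrightarrow> survives n a (k - 1) e \<and> a e \<le> t"
  by (simp add: Gedges_def)

lemma Gedges_mono: "s \<le> t \<Longrightarrow> Gedges n a k s \<subseteq> Gedges n a k t"
  by (auto simp: Gedges_def)

lemma Gedges_antimono_level: "j \<le> k \<Longrightarrow> Gedges n a k s \<subseteq> Gedges n a j s"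
  by (auto simp: Gedges_def intro: survives_antimono)

lemma joined_at_imp_before: "s < b \<Longrightarrow> joined_at n a k s p \<Longrightarrow> joined_before n a k b p"
  unfolding joined_at_def joined_before_def Gedges_def
  by (erule disj_forward) (auto elim!: connected_in_mono[rotated])

lemma joined_before_imp_at: "b \<le> s \<Longrightarrow> joined_before n a k b p \<Longrightarrow> joined_at n a k s p"
  unfolding joined_at_def joined_before_def Gedges_def
  by (erule disj_forward) (auto elim!: connected_in_mono[rotated])

section \<open>Dependence on the past only\<close>

definition agree_below :: "nat \<Rightarrow> (edge \<Rightarrow> real) \<Rightarrow> (edge \<Rightarrow> real) \<Rightarrow> real \<Rightarrow> bool" where
  "agree_below n a a' b \<longleftrightarrow> (\<forall>e\<in>all_edges n. a e < b \<or> a' e < b \<longrightarrow> a e = a' e)"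

text \<open>Only strictly earlier arrivals decide survival; hence the edge may arrive exactly at
  \<open>b\<close> although the configurations agree only before \<open>b\<close>.\<close>

lemma survives_cong:
  assumes "agree_below n a a' b" "a e = a' e" "a e \<le> b"
  shows "survives n a k e = survives n a' k e"
  using assms(2,3)
proof (induction k arbitrary: e)
  case (Suc k)
  have "{e'. survives n a k e' \<and> a e' < a e} = {e'. survives n a' k e' \<and> a' e' < a' e}"
  proof (intro Collect_cong)
    fix e'
    show "survives n a k e' \<and> a e' < a e \<longleftrightarrow> survives n a' k e' \<and> a' e' < a' e"
    proof (cases "e' \<in> all_edges n \<and> (a e' < a e \<or> a' e' < a e)")
      case True
      then have "a e' < b \<or> a' e' < b" using Suc.prems(2) by linarith
      then have eq: "a e' = a' e'"
        using assms(1) True unfolding agree_below_def by blast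
      have "survives n a k e' = survives n a' k e'" if "a e' < a e"
        using Suc.IH[OF eq] that Suc.prems(2) by simp
      with eq Suc.prems(1) show ?thesis by auto
    next
      case False
      then show ?thesis using Suc.prems by (auto dest: survives_all_edges)
    qed
  qed
  with Suc show ?case by simp
qed simp

lemma survives_before_cong:
  assumes "agree_below n a a' b"
  shows "{e. survives n a k e \<and> a e < b} = {e. survives n a' k e \<and> a' e < b}"
proof (intro Collect_cong)
  fix e
  show "survives n a k e \<and> a e < b \<longleftrightarrow> survives n a' k e \<and> a' e < b"
  proof (cases "e \<in> all_edges n \<and> (a e < b \<or> a' e < b)")
    case True
    then have "a e = a' e" using assms unfolding agree_below_def by blast
    with True survives_cong[OF assms this] show ?thesis by auto
  qed (auto dest: survives_all_edges)
qed

lemma joined_before_cong: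
  "agree_below n a a' b \<Longrightarrow> joined_before n a k b p = joined_before n a' k b p"
  unfolding joined_before_def by (subst survives_before_cong) auto

lemma Gedges_cong:
  assumes "agree_below n a a' b" "s < b"
  shows "Gedges n a k s = Gedges n a' k s"
proof -
  have "e \<in> Gedges n a k s \<longleftrightarrow> e \<in> Gedges n a' k s" for e
  proof (cases "e \<in> all_edges n \<and> (a e < b \<or> a' e < b)")
    case True
    then have "a e = a' e" using assms(1) unfolding agree_below_def by blast
    with True survives_cong[OF assms(1) this] show ?thesis by (auto simp: Gedges_def)
  next
    case False
    then show ?thesis using assms(2) by (auto simp: Gedges_def dest: survives_all_edges)
  qed
  then show ?thesis by blast
qed

lemma joined_at_cong:
  "agree_below n a a' b \<Longrightarrow> s < b \<Longrightarrow> joined_at n a k s p = joined_at n a' k s p"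
  unfolding joined_at_def by (subst Gedges_cong) auto

text \<open>Two vertex sets, each connected at level \<open>k\<close>, get connected to each other one level at a
  time: an edge between them in the \<open>j\<close>-th interval survives to level \<open>j\<close> because at
  that time they are already connected at level \<open>j - 1\<close>.\<close>
lemma levelwise_merge:
  assumes k: "k \<ge> 1" and d: "d > 0"
    and edges: "\<And>j. 1 \<le> j \<Longrightarrow> j \<le> k \<Longrightarrow> \<exists>e\<in>all_edges n.
        s + real (j - 1) * d < a e \<and> a e \<le> s + real j * d \<and>
        (connected_in (Gedges n a k s) u (fst (fst e)) \<and> connected_in (Gedges n a k s) v (snd (fst e)) \<or>
         connected_in (Gedges n a k s) u (snd (fst e)) \<and> connected_in (Gedges n a k s) v (fst (fst e)))"
  shows "connected_in (Gedges n a k (s + real k * d)) u v"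
proof -
  have "connected_in (Gedges n a j (s + real j * d)) u v" if "1 \<le> j" "j \<le> k" for j
    using that
  proof (induction j)
    case (Suc j)
    let ?s = "s + real j * d" and ?t = "s + real (Suc j) * d"
    obtain e where e: "e \<in> all_edges n" "?s < a e" "a e \<le> ?t" and
      disj: "connected_in (Gedges n a k s) u (fst (fst e)) \<and> connected_in (Gedges n a k s) v (snd (fst e)) \<or>
         connected_in (Gedges n a k s) u (snd (fst e)) \<and> connected_in (Gedges n a k s) v (fst (fst e))"
      using edges[of "Suc j"] Suc.prems by auto
    have up: "connected_in (Gedges n a i t) x y"
      if "connected_in (Gedges n a k s) x y" "i \<le> k" "s \<le> t" for x y i t
      using that connected_in_mono[of "Gedges n a k s" "Gedges n a i t"]
        Gedges_mono[of s t n a i] Gedges_antimono_level[of i k n a s] by blast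
    have st: "s \<le> ?s" "s \<le> ?t" using d by auto
    have transfer: "connected_in E u v \<longleftrightarrow> connected_in E (fst (fst e)) (snd (fst e))"
      if up: "\<And>x y. connected_in (Gedges n a k s) x y \<Longrightarrow> connected_in E x y" for E
      using disj
    proof
      assume "connected_in (Gedges n a k s) u (fst (fst e)) \<and> connected_in (Gedges n a k s) v (snd (fst e))"
      then show ?thesis by (intro connected_in_transfer up) auto
    next
      assume *: "connected_in (Gedges n a k s) u (snd (fst e)) \<and> connected_in (Gedges n a k s) v (fst (fst e))"
      have "connected_in E u v \<longleftrightarrow> connected_in E (snd (fst e)) (fst (fst e))"
        using * by (intro connected_in_transfer up) auto
      then show ?thesis using connected_in_sym by blast
    qed
    \<comment> \<open>The edge runs between the sets of \<open>u\<close> and \<open>v\<close>, so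
      its endpoints are joined at level \<open>j\<close> as soon as \<open>u\<close> and
      \<open>v\<close> are; this is the induction hypothesis, and at level 0 it is free.\<close>
    have "joined_at n a j ?s (fst e)"
    proof (cases "j = 0")
      case False
      then have "connected_in (Gedges n a j ?s) u v" using Suc by simp
      then have "connected_in (Gedges n a j ?s) (fst (fst e)) (snd (fst e))"
        by (subst transfer[symmetric]) (use up Suc.prems st in auto)
      then show ?thesis by (simp add: joined_at_def)
    qed (simp add: joined_at_def)
    then have "survives n a j e"
      using e joined_at_imp_before survives_iff by blast
    then have "e \<in> Gedges n a (Suc j) ?t"
      using e by (simp add: Gedges_def)
    then have "connected_in (Gedges n a (Suc j) ?t) (fst (fst e)) (snd (fst e))"
      by (rule connected_in_edge)
    then show ?case
      by (subst transfer) (use up Suc.prems st in auto)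
  qed simp
  with k show ?thesis by blast
qed

section \<open>Component sizes and the number of connected pairs\<close>

definition conn_rel :: "nat \<Rightarrow> edge set \<Rightarrow> (nat \<times> nat) set" where
  "conn_rel n E = {(u, v). u < n \<and> v < n \<and> connected_in E u v}"

lemma finite_conn_rel [simp]: "finite (conn_rel n E)"
  by (rule finite_subset[of _ "{..<n} \<times> {..<n}"]) (auto simp: conn_rel_def)

lemma finite_vpairs [simp]: "finite (vpairs n)"
  by (rule finite_subset[of _ "{..<n} \<times> {..<n}"]) (auto simp: vpairs_def)

lemma conn_rel_Image: "u < n \<Longrightarrow> conn_rel n E `` {u} = {v. v < n \<and> connected_in E u v}"
  by (auto simp: conn_rel_def)

lemma C1_ge: "v < n \<Longrightarrow> card (conn_rel n E `` {v}) \<le> C1 n E"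
  unfolding C1_def by (intro Max_ge) (auto simp: conn_rel_Image)

lemma C1_attained:
  assumes "n \<ge> 1"
  obtains v where "v < n" "card (conn_rel n E `` {v}) = C1 n E"
proof -
  have "C1 n E \<in> (\<lambda>v. card {u. u < n \<and> connected_in E v u}) ` {..<n}"
    unfolding C1_def using assms by (intro Max_in) (auto simp: lessThan_empty_iff)
  then show ?thesis using that conn_rel_Image by force
qed

lemma C1_le: "n \<ge> 1 \<Longrightarrow> C1 n E \<le> n"
proof -
  assume "n \<ge> 1"
  then obtain v where v: "v < n" "card (conn_rel n E `` {v}) = C1 n E" by (rule C1_attained)
  have "card (conn_rel n E `` {v}) \<le> card {..<n}"
    by (intro card_mono) (auto simp: conn_rel_def)
  then show ?thesis using v by simp
qed

lemma card_conn_rel: "card (conn_rel n E) = (\<Sum>v<n. card (conn_rel n E `` {v}))"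
proof -
  have "conn_rel n E = Sigma {..<n} (\<lambda>v. conn_rel n E `` {v})"
    by (auto simp: conn_rel_def)
  moreover have "finite (conn_rel n E `` {v})" for v
    by (rule finite_subset[of _ "{..<n}"]) (auto simp: conn_rel_def)
  ultimately show ?thesis
    by (metis card_SigmaI finite_lessThan)
qed

text \<open>The diagonal contributes \<open>n\<close>, and each unordered pair occurs in both
  orientations.\<close>

lemma card_conn_rel_vpairs:
  "card (conn_rel n E) = n + 2 * card {p \<in> vpairs n. connected_in E (fst p) (snd p)}"
proof -
  let ?U = "{p \<in> vpairs n. connected_in E (fst p) (snd p)}"
  let ?D = "(\<lambda>u. (u, u)) ` {..<n}"
  have "conn_rel n E = ?D \<union> (?U \<union> prod.swap ` ?U)" (is "_ = ?R")
  proof (intro equalityI subsetI)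
    fix x assume "x \<in> conn_rel n E"
    then obtain u v where x: "x = (u, v)" "u < n" "v < n" "connected_in E u v"
      by (auto simp: conn_rel_def)
    consider "u = v" | "u < v" | "v < u" by linarith
    then show "x \<in> ?R"
    proof cases
      case 3
      then have "(v, u) \<in> ?U" using x by (auto simp: vpairs_def dest: connected_in_sym)
      then have "prod.swap (v, u) \<in> prod.swap ` ?U" by (rule imageI)
      then show ?thesis using x by simp
    qed (use x in \<open>auto simp: vpairs_def\<close>)
  qed (auto simp: vpairs_def conn_rel_def connected_in_refl dest: connected_in_sym)
  moreover have "card ?D = n" by (subst card_image) (auto simp: inj_on_def)
  moreover have "card (prod.swap ` ?U) = card ?U" by (rule card_image) (auto simp: inj_on_def)
  moreover have "?U \<inter> prod.swap ` ?U = {}" "?D \<inter> (?U \<union> prod.swap ` ?U) = {}"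
    by (auto simp: vpairs_def)
  moreover have "finite ?U" by simp
  ultimately show ?thesis by (simp add: card_Un_disjoint)
qed

lemma card_vpairs: "n * n = n + 2 * card (vpairs n)"
proof -
  have "connected_in UNIV u v" for u v
    using connected_in_edge[of "((u,v),0)" UNIV] by simp
  then have "conn_rel n UNIV = {..<n} \<times> {..<n}" "{p \<in> vpairs n. connected_in UNIV (fst p) (snd p)} = vpairs n"
    by (auto simp: conn_rel_def)
  with card_conn_rel_vpairs[of n "UNIV"] show ?thesis by (simp add: card_cartesian_product)
qed

lemma C1_square_le:
  assumes "n \<ge> 1" shows "C1 n E * C1 n E \<le> card (conn_rel n E)"
proof -
  obtain v where v: "v < n" "card (conn_rel n E `` {v}) = C1 n E" using C1_attained[OF assms] .
  let ?A = "conn_rel n E `` {v}"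
  have "?A \<times> ?A \<subseteq> conn_rel n E"
    using connected_in_transfer[of E v _ v] connected_in_refl by (fastforce simp: conn_rel_def)
  then have "card (?A \<times> ?A) \<le> card (conn_rel n E)" by (rule card_mono[rotated]) simp
  then show ?thesis using v by (simp add: card_cartesian_product)
qed

text \<open>Sum the component size over all vertices: each of the \<open>C1\<close> vertices of the
  giant contributes \<open>C1\<close>, every other vertex at most \<open>c\<close>.\<close>

lemma conn_rel_le_of_unique_giant:
  assumes v: "v < n" "card (conn_rel n E `` {v}) = C1 n E"
    and small: "\<And>w. w < n \<Longrightarrow> \<not> connected_in E v w \<Longrightarrow> real (card (conn_rel n E `` {w})) \<le> c"
    and c: "c \<ge> 0"
  shows "real (card (conn_rel n E)) \<le> real (C1 n E) ^ 2 + c * real n"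
proof -
  let ?A = "conn_rel n E `` {v}"
  have fin: "finite ?A" "?A \<subseteq> {..<n}" by (auto simp: conn_rel_def intro: finite_subset[of _ "{..<n}"])
  have "real (card (conn_rel n E)) = (\<Sum>w<n. real (card (conn_rel n E `` {w})))"
    by (simp add: card_conn_rel)
  also have "\<dots> = (\<Sum>w\<in>?A. real (card (conn_rel n E `` {w}))) + (\<Sum>w\<in>{..<n} - ?A. real (card (conn_rel n E `` {w})))"
    using fin by (subst sum.subset_diff[of ?A]) auto
  also have "\<dots> \<le> (\<Sum>w\<in>?A. real (C1 n E)) + (\<Sum>w\<in>{..<n} - ?A. c)"
  proof (intro add_mono sum_mono)
    fix w assume "w \<in> ?A"
    then show "real (card (conn_rel n E `` {w})) \<le> real (C1 n E)"
      using C1_ge[of w n E] fin by auto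
  next
    fix w assume "w \<in> {..<n} - ?A"
    then show "real (card (conn_rel n E `` {w})) \<le> c"
      using small[of w] v by (auto simp: conn_rel_def)
  qed
  also have "\<dots> \<le> real (C1 n E) ^ 2 + c * real n"
  proof -
    have "real (card ({..<n} - ?A)) \<le> real n"
      using card_mono[of "{..<n}" "{..<n} - ?A"] by auto
    then show ?thesis using v c by (simp add: power2_eq_square mult.commute mult_left_mono)
  qed
  finally show ?thesis .
qed

definition cross_pairs :: "nat \<Rightarrow> nat set \<Rightarrow> nat set \<Rightarrow> (nat \<times> nat) set" where
  "cross_pairs n A B = {p \<in> vpairs n. fst p \<in> A \<and> snd p \<in> B \<or> snd p \<in> A \<and> fst p \<in> B}"

text \<open>Sorting the two entries is injective on \<open>A \<times> B\<close> because disjointness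
  excludes that both orientations of a pair occur.\<close>

lemma card_cross_pairs:
  assumes "A \<subseteq> {..<n}" "B \<subseteq> {..<n}" "A \<inter> B = {}"
  shows "card A * card B \<le> card (cross_pairs n A B)"
proof -
  let ?f = "\<lambda>(u, v). (min u v, max u v) :: nat \<times> nat"
  have "inj_on ?f (A \<times> B)"
    using assms(3) by (auto simp: inj_on_def min_def max_def split: if_splits)
  moreover have "?f ` (A \<times> B) \<subseteq> cross_pairs n A B"
    using assms by (force simp: cross_pairs_def vpairs_def min_def max_def)
  moreover have "finite (cross_pairs n A B)" by (simp add: cross_pairs_def)
  ultimately have "card (A \<times> B) \<le> card (cross_pairs n A B)"
    by (rule card_inj_on_le)
  then show ?thesis by (simp add: card_cartesian_product)
qed

text \<open>Absolute values make the arrival times on a pair nondecreasing in every configuration, not just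
  almost surely. Setting the first clock of a pair to a value beyond the time horizon deletes the pair.\<close>
definition arr :: "(edge \<Rightarrow> real) \<Rightarrow> edge \<Rightarrow> real" where
  "arr x e = (\<Sum>l\<le>snd e. \<bar>x (fst e, l)\<bar>)"

lemma arr_first [simp]: "arr x (p, 0) = \<bar>x (p, 0)\<bar>"
  by (simp add: arr_def)

lemma arr_ge: "l \<le> m \<Longrightarrow> \<bar>x (p, l)\<bar> \<le> arr x (p, m)"
  unfolding arr_def by (simp, rule member_le_sum[of l "{..m}" "\<lambda>l. \<bar>x (p, l)\<bar>"]) auto

text \<open>No arrival on \<open>q\<close> precedes its first clock, so if both values of that clock
  are at least \<open>b\<close>, the pair is invisible before \<open>b\<close> in either
  configuration.\<close>

lemma agree_below_upd:
  assumes "b \<le> \<bar>y\<bar>" "b \<le> \<bar>z\<bar>"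
  shows "agree_below n (arr (x((q, 0) := y))) (arr (x((q, 0) := z))) b"
  unfolding agree_below_def
proof (intro ballI impI)
  fix e assume *: "arr (x((q, 0) := y)) e < b \<or> arr (x((q, 0) := z)) e < b"
  have "fst e \<noteq> q"
  proof
    assume q: "fst e = q"
    have ge: "\<bar>w\<bar> \<le> arr (x((q, 0) := w)) e" for w
      using arr_ge[of 0 "snd e" "x((q, 0) := w)" q] q by (cases e) simp
    from ge[of y] ge[of z] * assms show False by linarith
  qed
  then show "arr (x((q, 0) := y)) e = arr (x((q, 0) := z)) e"
    by (simp add: arr_def)
qed

lemma agree_below_upd':
  "b \<le> \<bar>x (q, 0)\<bar> \<Longrightarrow> b \<le> \<bar>z\<bar> \<Longrightarrow> agree_below n (arr x) (arr (x((q, 0) := z))) b"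
  using agree_below_upd[of b "x (q, 0)" z n x q] by simp

section \<open>Leave-one-out second moment\<close>

locale iid_coordinates = prob_space \<mu> for \<mu> :: "real measure" +
  fixes E :: "'i set"
  assumes sets_mu [simp, measurable_cong]: "sets \<mu> = sets borel"
begin

abbreviation P :: "('i \<Rightarrow> real) measure" where "P \<equiv> PiM E (\<lambda>_. \<mu>)"

lemma space_mu [simp]: "space \<mu> = UNIV"
  using sets_eq_imp_space_eq[OF sets_mu] by simp

sublocale P: product_prob_space "\<lambda>_. \<mu>" E
  by unfold_locales

lemma measurable_upd_pair:
  "c \<in> E \<Longrightarrow> (\<lambda>(x, y). x(c := y)) \<in> P \<Otimes>\<^sub>M \<mu> \<rightarrow>\<^sub>M P"
  unfolding split_beta'
  by (rule measurable_fun_upd[where J=E]) auto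

lemma measurable_upd: "c \<in> E \<Longrightarrow> (\<lambda>x. x(c := z)) \<in> P \<rightarrow>\<^sub>M P"
  by (rule measurable_fun_upd[where J=E]) auto

lemma measurable_upd_snd: "c \<in> E \<Longrightarrow> x \<in> space P \<Longrightarrow> (\<lambda>y. x(c := y)) \<in> \<mu> \<rightarrow>\<^sub>M P"
  by (rule measurable_fun_upd[where J=E]) auto

lemma space_upd: "c \<in> E \<Longrightarrow> x \<in> space P \<Longrightarrow> x(c := y) \<in> space P"
  by (auto simp: space_PiM PiE_iff extensional_def)

text \<open>Fubini in a single coordinate, phrased so that the infinite product need not be split:
  overwriting a coordinate by an independent copy preserves the law. It suffices to compare
  cylinders.\<close>

lemma resample_distr:
  assumes c: "c \<in> E"
  shows "distr (P \<Otimes>\<^sub>M \<mu>) P (\<lambda>(x, y). x(c := y)) = P" (is "?D = _")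
proof (rule measure_eqI_PiM_infinite)
  interpret PM: pair_prob_space P \<mu> ..
  show "finite_measure ?D"
    using PM.prob_space_distr[OF measurable_upd_pair[OF c]] prob_space.finite_measure by blast
  fix A J assume J: "finite J" "J \<subseteq> E" and A: "\<And>i. i \<in> J \<Longrightarrow> A i \<in> sets \<mu>"
  let ?X = "prod_emb E (\<lambda>_. \<mu>) J (Pi\<^sub>E J A)"
  let ?Y = "prod_emb E (\<lambda>_. \<mu>) (J - {c}) (Pi\<^sub>E (J - {c}) A)"
  \<comment> \<open>Outside the index set of the cylinder the resampled value is unconstrained and
    contributes a factor 1.\<close>
  let ?B = "if c \<in> J then A c else UNIV"
  have X: "?X \<in> sets P" "?Y \<in> sets P" using J A by (auto intro!: sets_PiM_I)
  have B: "?B \<in> sets \<mu>" using A by auto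
  have "(\<lambda>(x, y). x(c := y)) -` ?X \<inter> space (P \<Otimes>\<^sub>M \<mu>) = ?Y \<times> ?B"
    using J c
    by (auto simp: prod_emb_iff space_pair_measure space_PiM PiE_iff extensional_def split: if_splits)
  then have "emeasure ?D ?X = emeasure (P \<Otimes>\<^sub>M \<mu>) (?Y \<times> ?B)"
    using X measurable_upd_pair[OF c] by (simp add: emeasure_distr)
  also have "\<dots> = emeasure P ?Y * emeasure \<mu> ?B"
    using X B by (intro emeasure_pair_measure_Times) auto
  also have "emeasure P ?Y = (\<Prod>i\<in>J - {c}. emeasure \<mu> (A i))"
    using J A by (intro P.emeasure_PiM_emb) auto
  also have "(\<Prod>i\<in>J - {c}. emeasure \<mu> (A i)) * emeasure \<mu> ?B = (\<Prod>i\<in>J. emeasure \<mu> (A i))"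
  proof (cases "c \<in> J")
    case True
    then show ?thesis using J by (simp add: prod.remove[of J c] mult.commute)
  next
    case False
    then show ?thesis using emeasure_space_1 by simp
  qed
  also have "\<dots> = emeasure P ?X"
    using J A by (intro P.emeasure_PiM_emb[symmetric]) auto
  finally show "emeasure ?D ?X = emeasure P ?X" .
qed simp_all

lemma resample_integral:
  fixes F :: "('i \<Rightarrow> real) \<Rightarrow> real"
  assumes c: "c \<in> E" and F: "integrable P F"
  shows "(\<integral>x. F x \<partial>P) = (\<integral>x. (\<integral>y. F (x(c := y)) \<partial>\<mu>) \<partial>P)"
proof -
  interpret PM: pair_prob_space P \<mu> ..
  have int: "integrable (P \<Otimes>\<^sub>M \<mu>) (\<lambda>z. F (case z of (x, y) \<Rightarrow> x(c := y)))"
    by (rule integrable_distr[OF measurable_upd_pair[OF c]]) (simp add: resample_distr[OF c] F)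
  have "(\<integral>x. F x \<partial>P) = (\<integral>x. F x \<partial>distr (P \<Otimes>\<^sub>M \<mu>) P (\<lambda>(x, y). x(c := y)))"
    by (simp add: resample_distr[OF c])
  also have "\<dots> = (\<integral>z. F (case z of (x, y) \<Rightarrow> x(c := y)) \<partial>(P \<Otimes>\<^sub>M \<mu>))"
    using measurable_upd_pair[OF c] F by (intro integral_distr) auto
  also have "\<dots> = (\<integral>x. (\<integral>y. F (x(c := y)) \<partial>\<mu>) \<partial>P)"
    using PM.integral_fst'[OF int] by simp
  finally show ?thesis .
qed

lemma prob_coordinates:
  assumes "finite J" "J \<subseteq> E" "A \<in> sets borel"
  shows "measure P {x \<in> space P. \<forall>i\<in>J. x i \<in> A} = measure \<mu> A ^ card J"
proof -
  have "emeasure P {x \<in> space P. \<forall>i\<in>J. x i \<in> A} = (\<Prod>i\<in>J. emeasure \<mu> A)"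
    using assms by (intro P.emeasure_PiM_Collect) auto
  then show ?thesis
    unfolding P.P.emeasure_eq_measure emeasure_eq_measure by (simp add: ennreal_power)
qed

end

text \<open>\<open>H p\<close> says that \<open>p\<close> is counted, \<open>c p\<close> is its
  clock, and \<open>K + 1\<close>, beyond the horizon \<open>K\<close>, is the value that deletes a
  clock. \<open>H_local\<close> is causality: deleting \<open>q\<close> cannot matter to
  \<open>p\<close> when \<open>q\<close> rings no earlier than \<open>p\<close>. Including ties here
  makes the remaining cases for \<open>p\<close> and for \<open>q\<close> mutually
  exclusive.\<close>

locale leave_one_out = iid_coordinates \<mu> E for \<mu> :: "real measure" and E :: "'i set" +
  fixes I :: "'p set" and c :: "'p \<Rightarrow> 'i" and K :: real and H :: "'p \<Rightarrow> ('i \<Rightarrow> real) \<Rightarrow> bool"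
  assumes finI: "finite I" and inj: "inj_on c I" and cE: "c ` I \<subseteq> E"
    and H_meas: "\<And>p. p \<in> I \<Longrightarrow> Measurable.pred P (H p)"
    and H_le: "\<And>p x. p \<in> I \<Longrightarrow> H p x \<Longrightarrow> \<bar>x (c p)\<bar> \<le> K"
    and H_local: "\<And>p q x. p \<in> I \<Longrightarrow> q \<in> I \<Longrightarrow> p \<noteq> q \<Longrightarrow> \<bar>x (c p)\<bar> \<le> K \<Longrightarrow>
        \<bar>x (c p)\<bar> \<le> \<bar>x (c q)\<bar> \<Longrightarrow> H p (x(c q := K + 1)) = H p x"
begin

definition compensator :: "'p \<Rightarrow> ('i \<Rightarrow> real) \<Rightarrow> real" where
  "compensator p x = (\<integral>y. of_bool (H p (x(c p := y))) \<partial>\<mu>)"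

definition D :: "'p \<Rightarrow> ('i \<Rightarrow> real) \<Rightarrow> real" where
  "D p x = of_bool (H p x) - compensator p x"

definition \<beta> :: real where "\<beta> = measure \<mu> {y. \<bar>y\<bar> \<le> K}"

definition early :: "'p \<Rightarrow> ('i \<Rightarrow> real) \<Rightarrow> real" where
  "early p x = of_bool (\<bar>x (c p)\<bar> \<le> K)"

lemma beta_le_1: "\<beta> \<le> 1" and beta_nonneg: "0 \<le> \<beta>"
  by (auto simp: \<beta>_def)

lemma H_real_meas: "p \<in> I \<Longrightarrow> (\<lambda>x. of_bool (H p x) :: real) \<in> borel_measurable P"
  using H_meas[of p] by measurable

lemma compensator_meas: assumes p: "p \<in> I" shows "compensator p \<in> borel_measurable P"
proof -
  have [measurable]: "(\<lambda>(x, y). x(c p := y)) \<in> P \<Otimes>\<^sub>M \<mu> \<rightarrow>\<^sub>M P"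
    using p cE by (intro measurable_upd_pair) auto
  have [measurable]: "(\<lambda>x. of_bool (H p x) :: real) \<in> borel_measurable P"
    using p by (rule H_real_meas)
  have "(\<lambda>z. of_bool (H p (case z of (x, y) \<Rightarrow> x(c p := y))) :: real) \<in> borel_measurable (P \<Otimes>\<^sub>M \<mu>)"
    by measurable
  then have "case_prod (\<lambda>x y. of_bool (H p (x(c p := y))) :: real) \<in> borel_measurable (P \<Otimes>\<^sub>M \<mu>)"
    by (simp add: split_beta')
  then show ?thesis unfolding compensator_def
    by (rule borel_measurable_lebesgue_integral)
qed

lemma D_meas: "p \<in> I \<Longrightarrow> D p \<in> borel_measurable P"
  unfolding D_def using H_real_meas compensator_meas by auto

lemma early_meas: "p \<in> I \<Longrightarrow> early p \<in> borel_measurable P"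
proof -
  assume p: "p \<in> I"
  have [measurable]: "(\<lambda>x. x (c p)) \<in> borel_measurable P"
    using p cE measurable_component_singleton[of "c p" E "\<lambda>_. \<mu>"] by auto
  show ?thesis unfolding early_def by measurable
qed

lemma upd_meas: "p \<in> I \<Longrightarrow> (\<lambda>x. x(c p := z)) \<in> P \<rightarrow>\<^sub>M P"
  using cE by (intro measurable_upd) auto

lemma upd_space: "p \<in> I \<Longrightarrow> x \<in> space P \<Longrightarrow> x(c p := z) \<in> space P"
  using cE by (intro space_upd) auto

lemma H_section_integrable:
  assumes "p \<in> I" "x \<in> space P"
  shows "integrable \<mu> (\<lambda>y. of_bool (H p (x(c p := y))) :: real)"
proof (rule integrable_const_bound[where B=1])
  show "(\<lambda>y. of_bool (H p (x(c p := y))) :: real) \<in> borel_measurable \<mu>"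
    using measurable_compose[OF measurable_upd_snd H_real_meas] assms cE by auto
qed auto

lemma compensator_bounds:
  assumes "p \<in> I" "x \<in> space P"
  shows "0 \<le> compensator p x" "compensator p x \<le> \<beta>"
proof -
  show "0 \<le> compensator p x" unfolding compensator_def by (rule integral_nonneg_AE) auto
  have "compensator p x \<le> (\<integral>y. indicator {y. \<bar>y\<bar> \<le> K} y \<partial>\<mu>)"
    unfolding compensator_def
  proof (rule integral_mono[OF H_section_integrable[OF assms]])
    show "integrable \<mu> (indicator {y. \<bar>y\<bar> \<le> K} :: real \<Rightarrow> real)"
      by (intro integrable_real_indicator) (auto simp: emeasure_eq_measure)
  qed (use H_le[OF assms(1)] in \<open>fastforce simp: indicator_def\<close>)
  then show "compensator p x \<le> \<beta>" by (simp add: \<beta>_def)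
qed

lemma D_bound: "p \<in> I \<Longrightarrow> x \<in> space P \<Longrightarrow> \<bar>D p x\<bar> \<le> 1"
  using compensator_bounds[of p x] beta_le_1 by (auto simp: D_def)

lemma compensator_upd: "compensator p (x(c p := z)) = compensator p x"
  by (simp add: compensator_def)

lemma D_section_mean:
  assumes "p \<in> I" "x \<in> space P"
  shows "(\<integral>y. D p (x(c p := y)) \<partial>\<mu>) = 0"
proof -
  have "(\<integral>y. D p (x(c p := y)) \<partial>\<mu>) = (\<integral>y. of_bool (H p (x(c p := y))) - compensator p x \<partial>\<mu>)"
    by (simp add: D_def compensator_upd)
  also have "\<dots> = 0"
    by (subst Bochner_Integration.integral_diff[OF H_section_integrable[OF assms]])
      (simp_all add: compensator_def prob_space[simplified])
  finally show ?thesis .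
qed

lemma integrable_bounded:
  fixes F :: "('i \<Rightarrow> real) \<Rightarrow> real"
  assumes "F \<in> borel_measurable P" "\<And>x. x \<in> space P \<Longrightarrow> \<bar>F x\<bar> \<le> B"
  shows "integrable P F"
  using assms by (intro P.integrable_const_bound[where B=B]) auto

text \<open>When the coordinate \<open>c p\<close> is integrated first, \<open>F\<close> is a
  constant factor and \<open>G\<close> averages to zero.\<close>

lemma orthogonal_to_other_coordinates:
  fixes F G :: "('i \<Rightarrow> real) \<Rightarrow> real"
  assumes p: "p \<in> I" and F: "F \<in> borel_measurable P" "\<And>x. x \<in> space P \<Longrightarrow> \<bar>F x\<bar> \<le> 1"
    and inv: "\<And>x y. x \<in> space P \<Longrightarrow> F (x(c p := y)) = F x"
    and G: "G \<in> borel_measurable P" "\<And>x. x \<in> space P \<Longrightarrow> \<bar>G x\<bar> \<le> 1"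
    and mean: "\<And>x. x \<in> space P \<Longrightarrow> (\<integral>y. G (x(c p := y)) \<partial>\<mu>) = 0"
  shows "(\<integral>x. G x * F x \<partial>P) = 0"
proof -
  have "integrable P (\<lambda>x. G x * F x)"
  proof (rule integrable_bounded[where B=1])
    show "\<bar>G x * F x\<bar> \<le> 1" if "x \<in> space P" for x
      using G(2)[OF that] F(2)[OF that] by (simp add: abs_mult mult_le_one)
  qed (use F G in auto)
  then have "(\<integral>x. G x * F x \<partial>P) = (\<integral>x. (\<integral>y. G (x(c p := y)) * F (x(c p := y)) \<partial>\<mu>) \<partial>P)"
    using p cE by (intro resample_integral) auto
  also have "\<dots> = (\<integral>x. 0 \<partial>P)"
    by (rule Bochner_Integration.integral_cong) (auto simp: inv mean)
  finally show ?thesis by simp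
qed

text \<open>By causality the indicator changes only if \<open>q\<close> rings strictly before
  \<open>p\<close>. The compensator changes by at most the average of this over the clock of
  \<open>p\<close>, which costs a factor \<beta> and still requires \<open>q\<close> to be
  early.\<close>

lemma D_diff_bound:
  assumes p: "p \<in> I" and q: "q \<in> I" and pq: "p \<noteq> q" and x: "x \<in> space P"
  shows "\<bar>D p x - D p (x(c q := K + 1))\<bar> \<le> of_bool (\<bar>x (c q)\<bar> < \<bar>x (c p)\<bar> \<and> \<bar>x (c p)\<bar> \<le> K) + \<beta> * early q x"
proof -
  have cpq: "c p \<noteq> c q" using p q pq inj by (auto dest: inj_onD)
  have H_diff: "\<bar>of_bool (H p x) - of_bool (H p (x(c q := K + 1)))\<bar>
      \<le> (of_bool (\<bar>x (c q)\<bar> < \<bar>x (c p)\<bar> \<and> \<bar>x (c p)\<bar> \<le> K) :: real)" for x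
    using H_local[OF p q pq, of x] H_le[OF p, of x] H_le[OF p, of "x(c q := K + 1)"] cpq
    by (cases "\<bar>x (c p)\<bar> \<le> K"; cases "\<bar>x (c p)\<bar> \<le> \<bar>x (c q)\<bar>") auto
  let ?f = "\<lambda>y. of_bool (H p (x(c p := y))) :: real"
  let ?g = "\<lambda>y. of_bool (H p (x(c q := K + 1, c p := y))) :: real"
  have int: "integrable \<mu> ?f" "integrable \<mu> ?g"
    using H_section_integrable[OF p] x upd_space[OF q] by auto
  have "\<bar>compensator p x - compensator p (x(c q := K + 1))\<bar> = \<bar>\<integral>y. ?f y - ?g y \<partial>\<mu>\<bar>"
    unfolding compensator_def using int by (subst Bochner_Integration.integral_diff) auto
  also have "\<dots> \<le> (\<integral>y. \<bar>?f y - ?g y\<bar> \<partial>\<mu>)"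
    by (rule integral_abs_bound)
  also have "\<dots> \<le> (\<integral>y. early q x * indicator {y. \<bar>y\<bar> \<le> K} y \<partial>\<mu>)"
  proof (rule integral_mono)
    show "integrable \<mu> (\<lambda>y. \<bar>?f y - ?g y\<bar>)" using int by auto
    show "integrable \<mu> (\<lambda>y. early q x * indicator {y. \<bar>y\<bar> \<le> K} y)"
      by (intro integrable_mult_right integrable_real_indicator) (auto simp: emeasure_eq_measure)
    fix y
    have "\<bar>?f y - ?g y\<bar> \<le> of_bool (\<bar>x (c q)\<bar> < \<bar>y\<bar> \<and> \<bar>y\<bar> \<le> K)"
      using H_diff[of "x(c p := y)"] cpq by (simp add: fun_upd_twist)
    also have "\<dots> \<le> early q x * indicator {y. \<bar>y\<bar> \<le> K} y"
      by (auto simp: early_def)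
    finally show "\<bar>?f y - ?g y\<bar> \<le> early q x * indicator {y. \<bar>y\<bar> \<le> K} y" .
  qed
  also have "\<dots> = \<beta> * early q x" by (simp add: \<beta>_def mult.commute)
  finally show ?thesis using H_diff[of x] unfolding D_def by linarith
qed

lemma early_pair_expectation:
  assumes "p \<in> I" "q \<in> I" "p \<noteq> q"
  shows "(\<integral>x. early p x * early q x \<partial>P) = \<beta>\<^sup>2"
proof -
  have cpq: "c p \<noteq> c q" using assms inj by (auto dest: inj_onD)
  let ?S = "{x \<in> space P. \<forall>i\<in>{c p, c q}. x i \<in> {y. \<bar>y\<bar> \<le> K}}"
  have "(\<integral>x. early p x * early q x \<partial>P) = (\<integral>x. indicator ?S x \<partial>P)"
    by (rule Bochner_Integration.integral_cong) (auto simp: early_def)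
  also have "\<dots> = measure P ?S"
    by (simp, intro arg_cong[where f="measure P"], blast)
  also have "\<dots> = \<beta>\<^sup>2"
    using cE assms cpq by (subst prob_coordinates) (auto simp: \<beta>_def power2_eq_square)
  finally show ?thesis .
qed

lemma early_expectation:
  assumes "p \<in> I"
  shows "(\<integral>x. early p x \<partial>P) = \<beta>"
proof -
  let ?S = "{x \<in> space P. \<forall>i\<in>{c p}. x i \<in> {y. \<bar>y\<bar> \<le> K}}"
  have "(\<integral>x. early p x \<partial>P) = (\<integral>x. indicator ?S x \<partial>P)"
    by (rule Bochner_Integration.integral_cong) (auto simp: early_def)
  also have "\<dots> = measure P ?S"
    by (simp, intro arg_cong[where f="measure P"], blast)
  also have "\<dots> = \<beta>"
    using cE assms by (subst prob_coordinates) (auto simp: \<beta>_def)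
  finally show ?thesis .
qed

lemma early_integrable: "p \<in> I \<Longrightarrow> integrable P (early p)"
  by (intro integrable_bounded[where B=1] early_meas) (auto simp: early_def)

text \<open>Since \<open>D p\<close> is at most 1 in absolute value, its square is bounded by that
  absolute value, whose mean is linear in \<beta>. This factor keeps the diagonal terms at O(n)
  instead of O(n^2).\<close>

lemma D_square_expectation:
  assumes p: "p \<in> I"
  shows "(\<integral>x. (D p x)\<^sup>2 \<partial>P) \<le> 2 * \<beta>"
proof -
  have "(\<integral>x. (D p x)\<^sup>2 \<partial>P) \<le> (\<integral>x. early p x + \<beta> \<partial>P)"
  proof (rule integral_mono)
    show "integrable P (\<lambda>x. (D p x)\<^sup>2)"
    proof (rule integrable_bounded[where B=1])
      show "\<bar>(D p x)\<^sup>2\<bar> \<le> 1" if "x \<in> space P" for x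
        using D_bound[OF p that] by (simp add: abs_square_le_1)
    qed (use D_meas[OF p] in auto)
    show "integrable P (\<lambda>x. early p x + \<beta>)" using early_integrable[OF p] by auto
    fix x assume x: "x \<in> space P"
    have "(D p x)\<^sup>2 \<le> \<bar>D p x\<bar>"
      using D_bound[OF p x] power_decreasing[of 1 2 "\<bar>D p x\<bar>"] by simp
    also have "\<dots> \<le> early p x + \<beta>"
      using compensator_bounds[OF p x] H_le[OF p, of x] by (auto simp: D_def early_def)
    finally show "(D p x)\<^sup>2 \<le> early p x + \<beta>" .
  qed
  also have "\<dots> = 2 * \<beta>"
    using early_expectation[OF p] early_integrable[OF p] P.P.prob_space by simp
  finally show ?thesis .
qed

text \<open>The indicator parts of the two differences have disjoint supports: \<open>q\<close> can influence \<open>H p\<close> only if it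
  arrives before \<open>p\<close>, and vice versa.\<close>
lemma D_covariance:
  assumes p: "p \<in> I" and q: "q \<in> I" and pq: "p \<noteq> q"
  shows "(\<integral>x. D p x * D q x \<partial>P) \<le> 3 * \<beta> ^ 3"
proof -
  have cpq: "c p \<noteq> c q" using p q pq inj by (auto dest: inj_onD)
  define Dp where "Dp x = D p (x(c q := K + 1))" for x
  define Dq where "Dq x = D q (x(c p := K + 1))" for x
  have meas: "D p \<in> borel_measurable P" "D q \<in> borel_measurable P"
    "Dp \<in> borel_measurable P" "Dq \<in> borel_measurable P"
    unfolding Dp_def Dq_def
    using D_meas[OF p] D_meas[OF q] upd_meas[OF p] upd_meas[OF q] by (auto intro: measurable_compose)
  have bnd: "\<bar>D p x\<bar> \<le> 1" "\<bar>D q x\<bar> \<le> 1" "\<bar>Dp x\<bar> \<le> 1" "\<bar>Dq x\<bar> \<le> 1" if "x \<in> space P" for x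
    unfolding Dp_def Dq_def
    using D_bound[OF p] D_bound[OF q] upd_space[OF p that] upd_space[OF q that] that by auto
  have int: "integrable P (\<lambda>x. F x * G x)" if "F \<in> {D p, D q, Dp, Dq}" "G \<in> {D p, D q, Dp, Dq}" for F G
  proof (rule integrable_bounded[where B=1])
    show "\<bar>F x * G x\<bar> \<le> 1" if "x \<in> space P" for x
    proof -
      have "\<bar>F x\<bar> \<le> 1" "\<bar>G x\<bar> \<le> 1" using bnd[OF that] \<open>F \<in> _\<close> \<open>G \<in> _\<close> by auto
      then show ?thesis unfolding abs_mult by (intro mult_le_one) auto
    qed
    show "(\<lambda>x. F x * G x) \<in> borel_measurable P" using meas that by auto
  qed
  have Dp_mean: "(\<integral>y. Dp (x(c p := y)) \<partial>\<mu>) = 0" if "x \<in> space P" for x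
    using D_section_mean[OF p upd_space[OF q that, of "K + 1"]] cpq by (simp add: Dp_def fun_upd_twist)
  have inv: "Dq (x(c p := y)) = Dq x" "Dp (x(c q := y)) = Dp x" for x y
    by (simp_all add: Dp_def Dq_def)
  have z1: "(\<integral>x. D p x * Dq x \<partial>P) = 0"
    by (rule orthogonal_to_other_coordinates[OF p meas(4) bnd(4) inv(1) meas(1) bnd(1) D_section_mean[OF p]])
  have z2: "(\<integral>x. D q x * Dp x \<partial>P) = 0"
    by (rule orthogonal_to_other_coordinates[OF q meas(3) bnd(3) inv(2) meas(2) bnd(2) D_section_mean[OF q]])
  have z3: "(\<integral>x. Dp x * Dq x \<partial>P) = 0"
    by (rule orthogonal_to_other_coordinates[OF p meas(4) bnd(4) inv(1) meas(3) bnd(3) Dp_mean])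
  have i1: "integrable P (\<lambda>x. D p x * Dq x)" and i2: "integrable P (\<lambda>x. D q x * Dp x)"
    and i3: "integrable P (\<lambda>x. Dp x * Dq x)"
    by (rule int; simp)+
  have i4: "integrable P (\<lambda>x. (D p x - Dp x) * (D q x - Dq x))"
  proof (rule integrable_bounded[where B="2 * 2"])
    show "\<bar>(D p x - Dp x) * (D q x - Dq x)\<bar> \<le> 2 * 2" if "x \<in> space P" for x
      unfolding abs_mult using bnd[OF that] by (intro mult_mono) auto
  qed (use meas in auto)
  have "(\<integral>x. D p x * D q x \<partial>P)
      = (\<integral>x. (D p x - Dp x) * (D q x - Dq x) + D p x * Dq x + D q x * Dp x - Dp x * Dq x \<partial>P)"
    by (rule Bochner_Integration.integral_cong) (auto simp: algebra_simps)
  also have "\<dots> = (\<integral>x. (D p x - Dp x) * (D q x - Dq x) \<partial>P)"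
    using i1 i2 i3 i4 z1 z2 z3 by simp
  also have "\<dots> \<le> (\<integral>x. 3 * \<beta> * (early p x * early q x) \<partial>P)"
  proof (rule integral_mono)
    show "integrable P (\<lambda>x. (D p x - Dp x) * (D q x - Dq x))" by (fact i4)
    show "integrable P (\<lambda>x. 3 * \<beta> * (early p x * early q x))"
    proof (rule integrable_mult_right, rule integrable_bounded[where B=1])
      show "\<bar>early p x * early q x\<bar> \<le> 1" for x by (simp add: early_def)
    qed (use early_meas[OF p] early_meas[OF q] in auto)
    fix x assume x: "x \<in> space P"
    let ?u = "of_bool (\<bar>x (c q)\<bar> < \<bar>x (c p)\<bar> \<and> \<bar>x (c p)\<bar> \<le> K) :: real"
    let ?v = "of_bool (\<bar>x (c p)\<bar> < \<bar>x (c q)\<bar> \<and> \<bar>x (c q)\<bar> \<le> K) :: real"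
    have "(D p x - Dp x) * (D q x - Dq x) \<le> \<bar>D p x - Dp x\<bar> * \<bar>D q x - Dq x\<bar>"
      by (metis abs_ge_self abs_mult)
    also have "\<dots> \<le> (?u + \<beta> * early q x) * (?v + \<beta> * early p x)"
      unfolding Dp_def Dq_def
      using D_diff_bound[OF p q pq x] D_diff_bound[OF q p pq[symmetric] x]
      by (intro mult_mono) (use beta_nonneg in \<open>simp_all add: early_def\<close>)
    \<comment> \<open>If one of the clocks is late, one factor is zero. Otherwise
      \<open>?u * ?v = 0\<close> and \<open>?u + ?v \<le> 1\<close>, so the product is at most
      \<beta> + \<beta>^2 \<le> 2 \<beta>; the constant 3 is generous.\<close>
    also have "\<dots> \<le> 3 * \<beta> * (early p x * early q x)"
    proof (cases "\<bar>x (c p)\<bar> \<le> K \<and> \<bar>x (c q)\<bar> \<le> K")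
      case True
      have "\<beta> * \<beta> \<le> \<beta>" using mult_left_mono[OF beta_le_1 beta_nonneg] by simp
      moreover consider "?u = 0" "?v = 0" | "?u = 1" "?v = 0" | "?u = 0" "?v = 1"
        by (cases "\<bar>x (c p)\<bar> < \<bar>x (c q)\<bar>"; cases "\<bar>x (c q)\<bar> < \<bar>x (c p)\<bar>") auto
      then have "(?u + \<beta>) * (?v + \<beta>) \<le> \<beta> + \<beta> * \<beta>"
        by cases (use beta_nonneg in \<open>simp_all add: algebra_simps\<close>)
      ultimately show ?thesis using True beta_nonneg by (simp add: early_def)
    next
      case False
      then show ?thesis by (auto simp: early_def)
    qed
    finally show "(D p x - Dp x) * (D q x - Dq x) \<le> 3 * \<beta> * (early p x * early q x)" .
  qed
  also have "\<dots> = 3 * \<beta> ^ 3"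
    using early_pair_expectation[OF p q pq] by (simp add: power3_eq_cube power2_eq_square)
  finally show ?thesis .
qed

lemma second_moment:
  "(\<integral>x. (\<Sum>p\<in>I. D p x)\<^sup>2 \<partial>P) \<le> 2 * \<beta> * card I + 3 * \<beta> ^ 3 * (card I)\<^sup>2"
proof -
  have int: "integrable P (\<lambda>x. D p x * D q x)" if "p \<in> I" "q \<in> I" for p q
  proof (rule integrable_bounded[where B=1])
    show "\<bar>D p x * D q x\<bar> \<le> 1" if "x \<in> space P" for x
      using D_bound[OF \<open>p \<in> I\<close> that] D_bound[OF \<open>q \<in> I\<close> that] by (simp add: abs_mult mult_le_one)
  qed (use D_meas that in auto)
  have "(\<integral>x. (\<Sum>p\<in>I. D p x)\<^sup>2 \<partial>P) = (\<integral>x. (\<Sum>p\<in>I. \<Sum>q\<in>I. D p x * D q x) \<partial>P)"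
    by (simp add: power2_eq_square sum_product)
  also have "\<dots> = (\<Sum>p\<in>I. \<Sum>q\<in>I. (\<integral>x. D p x * D q x \<partial>P))"
    using int by (simp add: Bochner_Integration.integral_sum)
  also have "\<dots> \<le> (\<Sum>p\<in>I. \<Sum>q\<in>I. (if q = p then 2 * \<beta> else 0) + 3 * \<beta> ^ 3)"
  proof (intro sum_mono)
    fix p q assume pq: "p \<in> I" "q \<in> I"
    show "(\<integral>x. D p x * D q x \<partial>P) \<le> (if q = p then 2 * \<beta> else 0) + 3 * \<beta> ^ 3"
    proof (cases "q = p")
      case True
      have "0 \<le> 3 * \<beta> ^ 3" using beta_nonneg by simp
      moreover have "(\<integral>x. D p x * D q x \<partial>P) \<le> 2 * \<beta>"
        using True D_square_expectation[OF pq(1)] by (simp add: power2_eq_square)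
      ultimately show ?thesis by (subst if_P[OF True]) linarith
    qed (use D_covariance[OF pq] in auto)
  qed
  also have "\<dots> = 2 * \<beta> * card I + 3 * \<beta> ^ 3 * (card I)\<^sup>2"
    using finI by (simp add: sum.distrib power2_eq_square algebra_simps)
  finally show ?thesis .
qed

lemma sum_D_square_integrable: "integrable P (\<lambda>x. (\<Sum>p\<in>I. D p x)\<^sup>2)"
proof (rule integrable_bounded[where B="(real (card I))\<^sup>2"])
  fix x assume x: "x \<in> space P"
  have "\<bar>\<Sum>p\<in>I. D p x\<bar> \<le> real (card I)"
    using order_trans[OF sum_abs sum_bounded_above[of I "\<lambda>p. \<bar>D p x\<bar>" 1]] D_bound[OF _ x] by simp
  then show "\<bar>(\<Sum>p\<in>I. D p x)\<^sup>2\<bar> \<le> (real (card I))\<^sup>2"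
    by (simp add: abs_le_square_iff[symmetric])
qed (intro borel_measurable_power borel_measurable_sum D_meas)

end

section \<open>Exponential clocks\<close>

text \<open>Asking for a measurable cover of the failure event makes the notion closed under
  implication even for conditions over all times, whose measurability is never examined.\<close>

definition whp :: "(nat \<Rightarrow> 'a measure) \<Rightarrow> (nat \<Rightarrow> 'a \<Rightarrow> bool) \<Rightarrow> bool" where
  "whp M \<phi> \<longleftrightarrow> (\<exists>A. (\<forall>n. A n \<in> sets (M n)) \<and> (\<forall>n. {\<omega> \<in> space (M n). \<not> \<phi> n \<omega>} \<subseteq> A n) \<and>
     (\<lambda>n. measure (M n) (A n)) \<longlonglongrightarrow> 0)"

lemma sup_to_zero_iff_whp:
  "sup_to_zero_in_prob M I D \<longleftrightarrow> (\<forall>\<epsilon>>0. whp M (\<lambda>n \<omega>. \<forall>t\<in>I. D n \<omega> t \<le> \<epsilon>))"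
proof -
  have "{\<omega> \<in> space (M n). \<exists>t\<in>I. D n \<omega> t > \<epsilon>} = {\<omega> \<in> space (M n). \<not> (\<forall>t\<in>I. D n \<omega> t \<le> \<epsilon>)}" for n \<epsilon>
    by (auto simp: not_le)
  then show ?thesis unfolding sup_to_zero_in_prob_def whp_def by simp
qed

lemma whpI_eventually:
  assumes A: "\<And>n. n \<ge> m \<Longrightarrow> A n \<in> sets (M n)"
    and sub: "\<And>n \<omega>. n \<ge> m \<Longrightarrow> \<omega> \<in> space (M n) \<Longrightarrow> \<not> \<phi> n \<omega> \<Longrightarrow> \<omega> \<in> A n"
    and lim: "(\<lambda>n. measure (M n) (A n)) \<longlonglongrightarrow> 0"
  shows "whp M \<phi>"
  unfolding whp_def
proof (intro exI[of _ "\<lambda>n. if n \<ge> m then A n else space (M n)"] conjI allI)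
  have "eventually (\<lambda>n. measure (M n) (A n) = measure (M n) (if n \<ge> m then A n else space (M n))) sequentially"
    by (rule eventually_sequentiallyI[of m]) auto
  then show "(\<lambda>n. measure (M n) (if n \<ge> m then A n else space (M n))) \<longlonglongrightarrow> 0"
    using lim by (rule Lim_transform_eventually[rotated])
qed (use A sub in auto)

lemma whp_mono:
  assumes "whp M \<phi>" and "\<And>n \<omega>. n \<ge> m \<Longrightarrow> \<omega> \<in> space (M n) \<Longrightarrow> \<phi> n \<omega> \<Longrightarrow> \<psi> n \<omega>"
  shows "whp M \<psi>"
proof -
  obtain A where A: "\<And>n. A n \<in> sets (M n)" "\<And>n. {\<omega> \<in> space (M n). \<not> \<phi> n \<omega>} \<subseteq> A n"
    "(\<lambda>n. measure (M n) (A n)) \<longlonglongrightarrow> 0"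
    using assms(1) unfolding whp_def by blast
  show ?thesis
    by (rule whpI_eventually[of m A]) (use A assms(2) in blast)+
qed

lemma whp_conj:
  assumes "whp M \<phi>" "whp M \<psi>"
  shows "whp M (\<lambda>n \<omega>. \<phi> n \<omega> \<and> \<psi> n \<omega>)"
proof -
  obtain A where A: "\<And>n. A n \<in> sets (M n)" "\<And>n. {\<omega> \<in> space (M n). \<not> \<phi> n \<omega>} \<subseteq> A n"
    "(\<lambda>n. measure (M n) (A n)) \<longlonglongrightarrow> 0"
    using assms(1) unfolding whp_def by blast
  obtain B where B: "\<And>n. B n \<in> sets (M n)" "\<And>n. {\<omega> \<in> space (M n). \<not> \<psi> n \<omega>} \<subseteq> B n"
    "(\<lambda>n. measure (M n) (B n)) \<longlonglongrightarrow> 0"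
    using assms(2) unfolding whp_def by blast
  show ?thesis
  proof (rule whpI_eventually[of 1 "\<lambda>n. A n \<union> B n"])
    show "(\<lambda>n. measure (M n) (A n \<union> B n)) \<longlonglongrightarrow> 0"
    proof (rule tendsto_sandwich[of "\<lambda>_. 0" _ _ "\<lambda>n. measure (M n) (A n) + measure (M n) (B n)"])
      show "eventually (\<lambda>n. measure (M n) (A n \<union> B n) \<le> measure (M n) (A n) + measure (M n) (B n)) sequentially"
        by (rule eventually_sequentiallyI[of 1])
          (intro measure_Un_le A B)
    qed (use tendsto_add[OF A(3) B(3)] in auto)
    show "\<omega> \<in> A n \<union> B n" if "\<omega> \<in> space (M n)" "\<not> (\<phi> n \<omega> \<and> \<psi> n \<omega>)" for n \<omega>
      using that A(2)[of n] B(2)[of n] by blast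
  qed (use A B in auto)
qed

lemma whp_True: "whp M (\<lambda>_ _. True)"
  unfolding whp_def by (intro exI[of _ "\<lambda>_. {}"]) auto

lemma whp_finite_ball:
  assumes "finite I" and "\<And>i. i \<in> I \<Longrightarrow> whp M (\<phi> i)"
  shows "whp M (\<lambda>n \<omega>. \<forall>i\<in>I. \<phi> i n \<omega>)"
  using assms
proof (induction I)
  case empty
  then show ?case using whp_True by simp
next
  case (insert i I)
  have "whp M (\<lambda>n \<omega>. \<phi> i n \<omega> \<and> (\<forall>i\<in>I. \<phi> i n \<omega>))"
    by (rule whp_conj) (use insert in auto)
  then show ?case by simp
qed

lemma whp_AE:
  assumes "\<And>n. n \<ge> 1 \<Longrightarrow> AE \<omega> in M n. \<phi> n \<omega>"
  shows "whp M \<phi>"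
proof -
  have "\<exists>N. N \<in> sets (M n) \<and> {\<omega> \<in> space (M n). \<not> \<phi> n \<omega>} \<subseteq> N \<and> measure (M n) N = 0" if "n \<ge> 1" for n
    using assms[OF that] by (auto elim!: AE_E simp: measure_def)
  then obtain N where N: "\<And>n. n \<ge> 1 \<Longrightarrow> N n \<in> sets (M n) \<and> {\<omega> \<in> space (M n). \<not> \<phi> n \<omega>} \<subseteq> N n \<and> measure (M n) (N n) = 0"
    by metis
  show ?thesis
  proof (rule whpI_eventually[of 1 N])
    have "eventually (\<lambda>n. 0 = measure (M n) (N n)) sequentially"
      by (rule eventually_sequentiallyI[of 1]) (use N in auto)
    then show "(\<lambda>n. measure (M n) (N n)) \<longlonglongrightarrow> 0"
      by (rule Lim_transform_eventually[OF tendsto_const])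
  qed (use N in blast)+
qed

lemma whp_Markov:
  fixes f :: "nat \<Rightarrow> 'a \<Rightarrow> real"
  assumes int: "\<And>n. n \<ge> 1 \<Longrightarrow> integrable (M n) (f n)"
    and nonneg: "\<And>n \<omega>. 0 \<le> f n \<omega>"
    and le: "\<And>n. n \<ge> 1 \<Longrightarrow> (\<integral>\<omega>. f n \<omega> \<partial>M n) \<le> B n"
    and b: "\<And>n. n \<ge> 1 \<Longrightarrow> 0 < b n" and lim: "(\<lambda>n. B n / b n) \<longlonglongrightarrow> 0"
  shows "whp M (\<lambda>n \<omega>. f n \<omega> < b n)"
proof (rule whpI_eventually[of 1 "\<lambda>n. {\<omega> \<in> space (M n). b n \<le> f n \<omega>}"])
  show "{\<omega> \<in> space (M n). b n \<le> f n \<omega>} \<in> sets (M n)" if "n \<ge> 1" for n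
    using borel_measurable_integrable[OF int[OF that]] by measurable
  show "(\<lambda>n. measure (M n) {\<omega> \<in> space (M n). b n \<le> f n \<omega>}) \<longlonglongrightarrow> 0"
  proof (rule tendsto_sandwich[OF _ _ tendsto_const lim])
    show "eventually (\<lambda>n. measure (M n) {\<omega> \<in> space (M n). b n \<le> f n \<omega>} \<le> B n / b n) sequentially"
    proof (rule eventually_sequentiallyI[of 1])
      fix n :: nat assume n: "1 \<le> n"
      have "measure (M n) {\<omega> \<in> space (M n). b n \<le> f n \<omega>} \<le> (\<integral>\<omega>. f n \<omega> \<partial>M n) / b n"
        by (rule integral_Markov_inequality_measure[where A="{}"]) (use int n nonneg b in auto)
      also have "\<dots> \<le> B n / b n" using le[OF n] b[OF n] by (simp add: divide_right_mono)
      finally show "measure (M n) {\<omega> \<in> space (M n). b n \<le> f n \<omega>} \<le> B n / b n" .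
    qed
  qed auto
qed auto

text \<open>Only the covering events are pulled back, so no measurability of \<open>\<phi>\<close>
  is involved.\<close>

lemma whp_distr:
  assumes "whp N \<phi>" and V: "\<And>n. n \<ge> m \<Longrightarrow> V n \<in> M n \<rightarrow>\<^sub>M N n"
    and distr: "\<And>n. n \<ge> m \<Longrightarrow> distr (M n) (N n) (V n) = N n"
  shows "whp M (\<lambda>n \<omega>. \<phi> n (V n \<omega>))"
proof -
  obtain A where A: "\<And>n. A n \<in> sets (N n)" "\<And>n. {\<omega> \<in> space (N n). \<not> \<phi> n \<omega>} \<subseteq> A n"
    "(\<lambda>n. measure (N n) (A n)) \<longlonglongrightarrow> 0"
    using assms(1) unfolding whp_def by blast
  have eq: "measure (N n) (A n) = measure (M n) (V n -` A n \<inter> space (M n))" if "n \<ge> m" for n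
    using measure_distr[OF V[OF that] A(1)] distr[OF that] by simp
  show ?thesis
  proof (rule whpI_eventually[of m "\<lambda>n. V n -` A n \<inter> space (M n)"])
    show "(\<lambda>n. measure (M n) (V n -` A n \<inter> space (M n))) \<longlonglongrightarrow> 0"
      by (rule Lim_transform_eventually[OF A(3)], rule eventually_sequentiallyI[of m]) (use eq in auto)
    show "V n -` A n \<inter> space (M n) \<in> sets (M n)" if "n \<ge> m" for n
      using V[OF that] A(1) by (rule measurable_sets)
    fix n :: nat and \<omega> assume "m \<le> n" "\<omega> \<in> space (M n)" "\<not> \<phi> n (V n \<omega>)"
    then show "\<omega> \<in> V n -` A n \<inter> space (M n)"
      using A(2)[of n] measurable_space[OF V] by blast
  qed
qed

section \<open>The exponential law\<close>

definition expo :: "nat \<Rightarrow> real measure" where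
  "expo n = density lborel (exponential_density (1 / real n))"

lemma sets_expo: "sets (expo n) = sets borel"
  by (simp add: expo_def)

lemma prob_space_expo: "n \<ge> 1 \<Longrightarrow> prob_space (expo n)"
  unfolding expo_def by (rule prob_space_exponential_density) simp

lemma AE_expo_pos: "AE y in expo n. 0 < y"
proof -
  have "AE y in lborel. y \<noteq> (0::real)"
    by (rule AE_lborel_singleton)
  then show ?thesis unfolding expo_def
    by (subst AE_density) (auto simp: erlang_density_def elim!: AE_mp)
qed

lemma expo_interval:
  assumes n: "n \<ge> 1" and a: "0 \<le> a" "a \<le> b"
  shows "measure (expo n) {y. a < \<bar>y\<bar> \<and> \<bar>y\<bar> \<le> b} = exp (- a / n) - exp (- b / n)"
proof -
  interpret prob_space "expo n" using prob_space_expo[OF n] .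
  have sp: "space (expo n) = UNIV" by (simp add: expo_def)
  have d: "distributed (expo n) lborel (\<lambda>y. y) (exponential_density (1 / real n))"
    unfolding distributed_def by (simp add: expo_def distr_id2)
  have le: "prob {y. y \<le> c} = 1 - exp (- c / n)" if "0 \<le> c" for c
    using exponential_distributedD_le[OF d that] n sp by simp
  have "prob {y. a < \<bar>y\<bar> \<and> \<bar>y\<bar> \<le> b} = prob ({y. y \<le> b} - {y. y \<le> a})"
  proof (rule finite_measure_eq_AE)
    show "AE y in expo n. y \<in> {y. a < \<bar>y\<bar> \<and> \<bar>y\<bar> \<le> b} \<longleftrightarrow> y \<in> {y. y \<le> b} - {y. y \<le> a}"
      using AE_expo_pos[of n] by eventually_elim auto
  qed (auto simp: sets_expo)
  also have "\<dots> = prob {y. y \<le> b} - prob {y. y \<le> a}"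
    using a by (intro finite_measure_Diff) (auto simp: sets_expo)
  finally show ?thesis using le a by simp
qed

text \<open>The lower bound comes from exp(-b/n) \<ge> 1 - b/n. Its quadratic error, summed over at
  most n^2 pairs, stays bounded and is therefore negligible at scale n.\<close>

lemma expo_interval_bounds:
  assumes n: "n \<ge> 1" and a: "0 \<le> a" "a \<le> b"
  shows "measure (expo n) {y. a < \<bar>y\<bar> \<and> \<bar>y\<bar> \<le> b} \<le> (b - a) / n"
    and "measure (expo n) {y. a < \<bar>y\<bar> \<and> \<bar>y\<bar> \<le> b} \<ge> (b - a) / n - (b - a) * b / n\<^sup>2"
proof -
  have np: "real n > 0" using n by simp
  have eq: "exp (- a / n) - exp (- b / n) = exp (- b / n) * (exp ((b - a) / n) - 1)"
    by (simp add: right_diff_distrib exp_add[symmetric] diff_divide_distrib)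
  have eq': "exp (- a / n) - exp (- b / n) = exp (- a / n) * (1 - exp (- ((b - a) / n)))"
    by (simp add: right_diff_distrib exp_add[symmetric] diff_divide_distrib)
  have "exp (- a / n) * (1 - exp (- ((b - a) / n))) \<le> 1 * ((b - a) / n)"
    using exp_ge_add_one_self[of "- ((b - a) / n)"] a np
    by (intro mult_mono) (auto simp: divide_nonneg_pos)
  then show "measure (expo n) {y. a < \<bar>y\<bar> \<and> \<bar>y\<bar> \<le> b} \<le> (b - a) / n"
    using expo_interval[OF n a] eq' by simp
  have "(b - a) / n - (b - a) * b / n\<^sup>2 = (1 - b / n) * ((b - a) / n)"
    using np by (simp add: field_simps power2_eq_square)
  also have "\<dots> \<le> exp (- b / n) * ((b - a) / n)"
    using exp_ge_add_one_self[of "- b / n"] a np by (intro mult_right_mono) auto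
  also have "\<dots> \<le> exp (- b / n) * (exp ((b - a) / n) - 1)"
  proof (rule mult_left_mono)
    show "(b - a) / n \<le> exp ((b - a) / n) - 1"
      using exp_ge_add_one_self[of "(b - a) / n"] by linarith
  qed simp
  finally show "measure (expo n) {y. a < \<bar>y\<bar> \<and> \<bar>y\<bar> \<le> b} \<ge> (b - a) / n - (b - a) * b / n\<^sup>2"
    using expo_interval[OF n a] eq by simp
qed

lemma expo_early:
  assumes n: "n \<ge> 1" and K: "0 \<le> K"
  shows "measure (expo n) {y. \<bar>y\<bar> \<le> K} \<le> K / n"
proof -
  interpret prob_space "expo n" using prob_space_expo[OF n] .
  have "prob {y. \<bar>y\<bar> \<le> K} = prob {y. 0 < \<bar>y\<bar> \<and> \<bar>y\<bar> \<le> K}"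
  proof (rule finite_measure_eq_AE)
    show "AE y in expo n. y \<in> {y. \<bar>y\<bar> \<le> K} \<longleftrightarrow> y \<in> {y. 0 < \<bar>y\<bar> \<and> \<bar>y\<bar> \<le> K}"
      using AE_expo_pos[of n] by eventually_elim auto
  qed (auto simp: sets_expo)
  then show ?thesis using expo_interval_bounds(1)[OF n _ K] by simp
qed

section \<open>The product space of clocks and measurability\<close>

definition clocks :: "nat \<Rightarrow> (edge \<Rightarrow> real) measure" where
  "clocks n = PiM (all_edges n) (\<lambda>_. expo n)"

lemma iid_clocks: "n \<ge> 1 \<Longrightarrow> iid_coordinates (expo n)"
  unfolding iid_coordinates_def iid_coordinates_axioms_def
  by (simp add: prob_space_expo sets_expo)

lemma measurable_clock: "e \<in> all_edges n \<Longrightarrow> (\<lambda>x. x e) \<in> borel_measurable (clocks n)"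
  unfolding clocks_def
  using measurable_component_singleton[of e "all_edges n" "\<lambda>_. expo n"] measurable_cong_sets[OF refl sets_expo]
  by blast

lemma measurable_arr: "e \<in> all_edges n \<Longrightarrow> (\<lambda>x. arr x e) \<in> borel_measurable (clocks n)"
  unfolding arr_def
  by (intro borel_measurable_sum borel_measurable_abs measurable_clock) (auto simp: all_edges_def)

text \<open>Reachability is a countable union over path lengths, and each step of a path ranges over
  countably many vertices.\<close>

lemma connected_in_measurable:
  assumes "\<And>e. Measurable.pred M (\<lambda>x. e \<in> E x)"
  shows "Measurable.pred M (\<lambda>x. connected_in (E x) u v)"
proof -
  have [measurable]: "Measurable.pred M (\<lambda>x. adj (E x) u v)" for u v
    unfolding adj_def using assms by measurable
  have [measurable]: "Measurable.pred M (\<lambda>x. (adj (E x) ^^ m) u v)" for m v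
  proof (induction m arbitrary: v)
    case 0
    then show ?case by simp
  next
    case (Suc m)
    note Suc [measurable]
    show ?case by (simp add: relcompp_apply) measurable
  qed
  show ?thesis unfolding connected_in_def rtranclp_power by measurable
qed

lemma survives_measurable: "Measurable.pred (clocks n) (\<lambda>x. survives n (arr x) k e)"
proof (induction k arbitrary: e)
  case 0
  then show ?case by simp
next
  case (Suc k)
  have "Measurable.pred (clocks n) (\<lambda>x. e' \<in> {e'. survives n (arr x) k e' \<and> arr x e' < arr x e})" if e: "e \<in> all_edges n" for e'
  proof (cases "e' \<in> all_edges n")
    case True
    note Suc [measurable] measurable_arr[OF True, measurable] measurable_arr[OF e, measurable]
    show ?thesis by simp
  next
    case False
    then have "\<not> survives n (arr x) k e'" for x using survives_all_edges by blast
    then show ?thesis by simp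
  qed
  note * = connected_in_measurable[OF this]
  show ?case
  proof (cases "e \<in> all_edges n")
    case True
    note Suc [measurable] *[OF True, measurable]
    show ?thesis by simp
  next
    case False
    then have "\<not> survives n (arr x) k e" for x using survives_all_edges by blast
    then show ?thesis by simp
  qed
qed

lemma Gedges_measurable: "Measurable.pred (clocks n) (\<lambda>x. e \<in> Gedges n (arr x) k t)"
proof (cases "e \<in> all_edges n")
  case True
  note survives_measurable [measurable] measurable_arr[OF True, measurable]
  show ?thesis by (simp add: Gedges_iff)
next
  case False
  then have "e \<notin> Gedges n (arr x) k t" for x by (auto simp: Gedges_iff dest: survives_all_edges)
  then show ?thesis by simp
qed

text \<open>An arbitrary \<open>Q\<close> is admissible because the relation takes only finitely
  many values. This covers vertex sets picked by \<open>SOME\<close> from the components.\<close>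

lemma conn_rel_measurable:
  "Measurable.pred (clocks n) (\<lambda>x. Q (conn_rel n (Gedges n (arr x) k t)))"
proof -
  let ?U = "{..<n} \<times> {..<n}"
  have [measurable]: "Measurable.pred (clocks n) (\<lambda>x. p \<in> conn_rel n (Gedges n (arr x) k t))" for p
    unfolding conn_rel_def using connected_in_measurable[OF Gedges_measurable, of n k t "fst p" "snd p"]
    by (cases p) simp
  have "Q (conn_rel n (Gedges n (arr x) k t)) \<longleftrightarrow>
      (\<exists>R\<in>Pow ?U. Q R \<and> (\<forall>p\<in>?U. p \<in> conn_rel n (Gedges n (arr x) k t) \<longleftrightarrow> p \<in> R))" for x
  proof
    assume "Q (conn_rel n (Gedges n (arr x) k t))"
    then show "\<exists>R\<in>Pow ?U. Q R \<and> (\<forall>p\<in>?U. p \<in> conn_rel n (Gedges n (arr x) k t) \<longleftrightarrow> p \<in> R)"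
      by (intro bexI[of _ "conn_rel n (Gedges n (arr x) k t)"]) (auto simp: conn_rel_def)
  next
    assume "\<exists>R\<in>Pow ?U. Q R \<and> (\<forall>p\<in>?U. p \<in> conn_rel n (Gedges n (arr x) k t) \<longleftrightarrow> p \<in> R)"
    then obtain R where R: "R \<subseteq> ?U" "Q R" "\<forall>p\<in>?U. p \<in> conn_rel n (Gedges n (arr x) k t) \<longleftrightarrow> p \<in> R"
      by blast
    have "conn_rel n (Gedges n (arr x) k t) \<subseteq> ?U" by (auto simp: conn_rel_def)
    with R have "conn_rel n (Gedges n (arr x) k t) = R" by blast
    with R show "Q (conn_rel n (Gedges n (arr x) k t))" by simp
  qed
  moreover have "countable (Pow ?U)" by (intro countable_finite) simp
  ultimately show ?thesis by simp
qed

lemma card_vpairs_le: "real (card (vpairs n)) \<le> (real n)\<^sup>2"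
proof -
  have "card (vpairs n) \<le> n * n" using card_vpairs[of n] by linarith
  then show ?thesis by (metis of_nat_le_iff of_nat_mult power2_eq_square)
qed

lemma vpairs_first: "p \<in> vpairs n \<Longrightarrow> (p, m) \<in> all_edges n"
  by (auto simp: all_edges_def)

section \<open>Arrivals in an interval\<close>

lemma real_card_Collect: "finite S \<Longrightarrow> real (card {p \<in> S. Q p}) = (\<Sum>p\<in>S. of_bool (Q p))"
  by (simp add: of_bool_def sum.If_cases Int_def)

text \<open>\<open>L\<close> and \<open>U\<close> sandwich the counting condition \<open>A\<close> of a pair and, up to pairs with an early
  arrival, do not depend on the clock of that pair.\<close>
locale interval_arrivals =
  fixes K s1 s2 :: real and A L U :: "nat \<Rightarrow> nat \<times> nat \<Rightarrow> (edge \<Rightarrow> real) \<Rightarrow> bool"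
  assumes s1: "0 \<le> s1" and s12: "s1 \<le> s2" and s2: "s2 \<le> K"
    and A_meas: "\<And>n p. n \<ge> 1 \<Longrightarrow> p \<in> vpairs n \<Longrightarrow> Measurable.pred (clocks n) (A n p)"
    and A_local: "\<And>n p q x. p \<in> vpairs n \<Longrightarrow> q \<in> vpairs n \<Longrightarrow> p \<noteq> q \<Longrightarrow>
        s1 < \<bar>x (p, 0)\<bar> \<Longrightarrow> \<bar>x (p, 0)\<bar> \<le> s2 \<Longrightarrow> \<bar>x (p, 0)\<bar> \<le> \<bar>x (q, 0)\<bar> \<Longrightarrow>
        A n p (x((q, 0) := K + 1)) = A n p x"
    and L_A: "\<And>n p x y. p \<in> vpairs n \<Longrightarrow> s1 < \<bar>y\<bar> \<Longrightarrow> \<bar>y\<bar> \<le> s2 \<Longrightarrow>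
        L n p (x((p, 0) := K + 1)) \<Longrightarrow> A n p (x((p, 0) := y))"
    and A_U: "\<And>n p x y. p \<in> vpairs n \<Longrightarrow> s1 < \<bar>y\<bar> \<Longrightarrow> \<bar>y\<bar> \<le> s2 \<Longrightarrow>
        A n p (x((p, 0) := y)) \<Longrightarrow> U n p (x((p, 0) := K + 1))"
    and L_upd: "\<And>n p x. p \<in> vpairs n \<Longrightarrow> K < \<bar>x (p, 0)\<bar> \<Longrightarrow> L n p x \<Longrightarrow> L n p (x((p, 0) := K + 1))"
    and U_upd: "\<And>n p x. p \<in> vpairs n \<Longrightarrow> K < \<bar>x (p, 0)\<bar> \<Longrightarrow> U n p (x((p, 0) := K + 1)) \<Longrightarrow> U n p x"
begin

definition H :: "nat \<Rightarrow> nat \<times> nat \<Rightarrow> (edge \<Rightarrow> real) \<Rightarrow> bool" where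
  "H n p x \<longleftrightarrow> A n p x \<and> s1 < \<bar>x (p, 0)\<bar> \<and> \<bar>x (p, 0)\<bar> \<le> s2"

definition mean :: "nat \<Rightarrow> nat \<times> nat \<Rightarrow> (edge \<Rightarrow> real) \<Rightarrow> real" where
  "mean n p x = (\<integral>y. of_bool (H n p (x((p, 0) := y))) \<partial>expo n)"

definition early :: "nat \<Rightarrow> (edge \<Rightarrow> real) \<Rightarrow> real" where
  "early n x = (\<Sum>p\<in>vpairs n. of_bool (\<bar>x (p, 0)\<bar> \<le> K))"

definition \<beta> :: "nat \<Rightarrow> real" where "\<beta> n = measure (expo n) {y. \<bar>y\<bar> \<le> K}"

definition \<mu>I :: "nat \<Rightarrow> real" where "\<mu>I n = measure (expo n) {y. s1 < \<bar>y\<bar> \<and> \<bar>y\<bar> \<le> s2}"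

lemma leave_one_out:
  assumes n: "n \<ge> 1"
  shows "leave_one_out (expo n) (all_edges n) (vpairs n) (\<lambda>p. (p, 0)) K (H n)"
proof -
  interpret iid_coordinates "expo n" "all_edges n" using iid_clocks[OF n] .
  show ?thesis
  proof unfold_locales
    fix p assume p: "p \<in> vpairs n"
    note A_meas[OF n p, measurable] measurable_clock[OF vpairs_first[OF p, of 0], measurable]
    have "Measurable.pred (clocks n) (H n p)" unfolding H_def by measurable
    then show "Measurable.pred P (H n p)" by (simp add: clocks_def)
  next
    fix p q and x :: "edge \<Rightarrow> real" assume "p \<in> vpairs n" "q \<in> vpairs n" "p \<noteq> q" "\<bar>x (p, 0)\<bar> \<le> \<bar>x (q, 0)\<bar>"
    then show "H n p (x((q, 0) := K + 1)) = H n p x"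
      using A_local[of p n q x] by (auto simp: H_def)
  qed (use s2 in \<open>auto simp: inj_on_def H_def all_edges_def\<close>)
qed

lemma beta_le: "n \<ge> 1 \<Longrightarrow> \<beta> n \<le> K / n" and beta_nonneg: "0 \<le> \<beta> n"
  unfolding \<beta>_def using expo_early s1 s12 s2 by auto

lemma muI_le_beta: assumes n: "n \<ge> 1" shows "\<mu>I n \<le> \<beta> n"
proof -
  interpret prob_space "expo n" using prob_space_expo[OF n] .
  show ?thesis unfolding \<mu>I_def \<beta>_def
    using s2 by (intro finite_measure_mono) (auto simp: sets_expo)
qed

text \<open>Averaging over the clock of \<open>p\<close> naturally gives bounds with
  \<open>p\<close> deleted. Restoring its actual clock is harmless if that clock is late; if it is
  early, the extra \<beta> absorbs everything, as the mean lies between 0 and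
  \<open>\<mu>I n \<le> \<beta> n\<close>.\<close>

lemma mean_bounds:
  assumes n: "n \<ge> 1" and p: "p \<in> vpairs n" and x: "x \<in> space (clocks n)"
  shows "\<mu>I n * of_bool (L n p x) - \<beta> n * of_bool (\<bar>x (p, 0)\<bar> \<le> K) \<le> mean n p x"
    and "mean n p x \<le> \<mu>I n * of_bool (U n p x) + \<beta> n * of_bool (\<bar>x (p, 0)\<bar> \<le> K)"
proof -
  interpret Loo: leave_one_out "expo n" "all_edges n" "vpairs n" "\<lambda>p. (p, 0)" K "H n"
    by (rule leave_one_out[OF n])
  let ?x = "x((p, 0) := K + 1)" and ?I = "{y. s1 < \<bar>y\<bar> \<and> \<bar>y\<bar> \<le> s2}"
  have int: "integrable (expo n) (\<lambda>y. of_bool (H n p (x((p, 0) := y))) :: real)"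
    using Loo.H_section_integrable[OF p] x by (simp add: clocks_def)
  have intI: "integrable (expo n) (\<lambda>y. indicator ?I y * c)" for c :: real
    by (intro integrable_mult_left integrable_real_indicator) (auto simp: Loo.emeasure_eq_measure sets_expo)
  have I: "(\<integral>y. indicator ?I y * c \<partial>expo n) = \<mu>I n * c" for c :: real
    by (simp add: \<mu>I_def)
  have "(\<integral>y. indicator ?I y * of_bool (L n p ?x) \<partial>expo n) \<le> mean n p x"
    unfolding mean_def
    by (rule integral_mono[OF intI int]) (use L_A[OF p] in \<open>auto simp: H_def indicator_def\<close>)
  then have 1: "\<mu>I n * of_bool (L n p ?x) \<le> mean n p x" unfolding I .
  have "mean n p x \<le> (\<integral>y. indicator ?I y * of_bool (U n p ?x) \<partial>expo n)"
    unfolding mean_def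
    by (rule integral_mono[OF int intI]) (use A_U[OF p] in \<open>auto simp: H_def indicator_def\<close>)
  then have 2: "mean n p x \<le> \<mu>I n * of_bool (U n p ?x)" unfolding I .
  have m: "0 \<le> \<mu>I n" "\<mu>I n \<le> \<beta> n" using muI_le_beta[OF n] by (auto simp: \<mu>I_def)
  show "\<mu>I n * of_bool (L n p x) - \<beta> n * of_bool (\<bar>x (p, 0)\<bar> \<le> K) \<le> mean n p x"
    using 1 m L_upd[OF p, of x] by (auto simp: not_le of_bool_def split: if_splits)
  show "mean n p x \<le> \<mu>I n * of_bool (U n p x) + \<beta> n * of_bool (\<bar>x (p, 0)\<bar> \<le> K)"
    using 2 m U_upd[OF p, of x] by (auto simp: not_le of_bool_def split: if_splits)
qed

text \<open>The expectation is at most n^2 (K/n)^2 = K^2, bounded in n, so Markov at scale n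
  applies.\<close>

lemma whp_early:
  fixes \<eta> :: real
  assumes "\<eta> > 0"
  shows "whp clocks (\<lambda>n x. \<beta> n * early n x < \<eta> * n)"
proof (rule whp_Markov[where B="\<lambda>_. K\<^sup>2"])
  have K: "0 \<le> K" using s1 s12 s2 by simp
  fix n :: nat assume n: "1 \<le> n"
  interpret L: leave_one_out "expo n" "all_edges n" "vpairs n" "\<lambda>p. (p, 0)" K "H n"
    by (rule leave_one_out[OF n])
  have eq: "\<beta> n * early n x = (\<Sum>p\<in>vpairs n. \<beta> n * L.early p x)" for x
    by (simp add: early_def L.early_def sum_distrib_left)
  have int: "integrable (clocks n) (\<lambda>x. \<beta> n * L.early p x)" if "p \<in> vpairs n" for p
    unfolding clocks_def using L.early_integrable[OF that] by (intro integrable_mult_right)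
  show "integrable (clocks n) (\<lambda>x. \<beta> n * early n x)"
    unfolding eq using int by (rule Bochner_Integration.integrable_sum)
  have "(\<integral>x. \<beta> n * early n x \<partial>clocks n) = (\<Sum>p\<in>vpairs n. \<integral>x. \<beta> n * L.early p x \<partial>clocks n)"
    unfolding eq using int by (rule Bochner_Integration.integral_sum)
  also have "\<dots> = (\<Sum>p\<in>vpairs n. \<beta> n * \<beta> n)"
    using L.early_expectation by (intro sum.cong) (auto simp: clocks_def L.\<beta>_def \<beta>_def)
  also have "\<dots> = real (card (vpairs n)) * (\<beta> n * \<beta> n)" by simp
  also have "\<dots> \<le> (real n)\<^sup>2 * (K / n * (K / n))"
    using card_vpairs_le beta_le[OF n] beta_nonneg[of n] K n by (intro mult_mono) auto
  also have "\<dots> = K\<^sup>2" using n by (simp add: power2_eq_square)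
  finally show "(\<integral>x. \<beta> n * early n x \<partial>clocks n) \<le> K\<^sup>2" .
  show "0 < \<eta> * n" using assms n by simp
next
  show "0 \<le> \<beta> n * early n x" for n x
    using beta_nonneg by (auto simp: early_def intro!: mult_nonneg_nonneg sum_nonneg)
  show "(\<lambda>n. K\<^sup>2 / (\<eta> * real n)) \<longlonglongrightarrow> 0"
    using tendsto_mult_right_zero[OF lim_1_over_n, of "K\<^sup>2 / \<eta>"] by simp
qed

text \<open>Chebyshev: the second moment is at most 2 \<beta> n^2 + 3 \<beta>^3 n^4 with \<beta>
  \<le> K/n, hence linear in n, against the squared threshold \<eta>^2 n^2.\<close>

lemma whp_deviation:
  fixes \<eta> :: real
  assumes "\<eta> > 0"
  shows "whp clocks (\<lambda>n x. \<bar>real (card {p \<in> vpairs n. H n p x}) - (\<Sum>p\<in>vpairs n. mean n p x)\<bar> < \<eta> * n)"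
proof -
  have K: "0 \<le> K" using s1 s12 s2 by simp
  define S where "S n x = real (card {p \<in> vpairs n. H n p x}) - (\<Sum>p\<in>vpairs n. mean n p x)" for n x
  have "whp clocks (\<lambda>n x. (S n x)\<^sup>2 < (\<eta> * n)\<^sup>2)"
  proof (rule whp_Markov[where B="\<lambda>n. (2 * K + 3 * K ^ 3) * n"])
    fix n :: nat assume n: "1 \<le> n"
    interpret L: leave_one_out "expo n" "all_edges n" "vpairs n" "\<lambda>p. (p, 0)" K "H n"
      by (rule leave_one_out[OF n])
    have eq: "S n x = (\<Sum>p\<in>vpairs n. L.D p x)" for x
      by (simp add: S_def real_card_Collect L.D_def L.compensator_def mean_def sum_subtractf)
    show "integrable (clocks n) (\<lambda>x. (S n x)\<^sup>2)"
      unfolding eq clocks_def by (rule L.sum_D_square_integrable)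
    have b: "L.\<beta> = \<beta> n" by (simp add: L.\<beta>_def \<beta>_def)
    have "(\<integral>x. (S n x)\<^sup>2 \<partial>clocks n) \<le> 2 * \<beta> n * card (vpairs n) + 3 * \<beta> n ^ 3 * (card (vpairs n))\<^sup>2"
      unfolding eq clocks_def using L.second_moment unfolding b .
    also have "\<dots> \<le> 2 * (K / n) * (real n)\<^sup>2 + 3 * (K / n) ^ 3 * ((real n)\<^sup>2)\<^sup>2"
    proof -
      have "(real (card (vpairs n)))\<^sup>2 \<le> ((real n)\<^sup>2)\<^sup>2"
        by (rule power_mono[OF card_vpairs_le]) simp
      moreover have "\<beta> n ^ 3 \<le> (K / n) ^ 3"
        by (rule power_mono[OF beta_le[OF n] beta_nonneg])
      ultimately show ?thesis
        using card_vpairs_le[of n] beta_le[OF n] beta_nonneg[of n] K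
        by (intro add_mono mult_mono) auto
    qed
    also have "\<dots> = (2 * K + 3 * K ^ 3) * n"
      using n by (simp add: power2_eq_square power3_eq_cube field_simps)
    finally show "(\<integral>x. (S n x)\<^sup>2 \<partial>clocks n) \<le> (2 * K + 3 * K ^ 3) * n" .
    show "0 < (\<eta> * n)\<^sup>2" using assms n by simp
  next
    have "(\<lambda>n. ((2 * K + 3 * K ^ 3) / \<eta>\<^sup>2) * (1 / real n)) \<longlonglongrightarrow> 0"
      by (rule tendsto_mult_right_zero[OF lim_1_over_n])
    moreover have "eventually (\<lambda>n. ((2 * K + 3 * K ^ 3) / \<eta>\<^sup>2) * (1 / real n)
        = (2 * K + 3 * K ^ 3) * n / (\<eta> * real n)\<^sup>2) sequentially"
      by (rule eventually_sequentiallyI[of 1]) (use assms in \<open>simp add: power2_eq_square field_simps\<close>)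
    ultimately show "(\<lambda>n. (2 * K + 3 * K ^ 3) * n / (\<eta> * real n)\<^sup>2) \<longlonglongrightarrow> 0"
      by (rule Lim_transform_eventually)
  qed simp
  then have "whp clocks (\<lambda>n x. \<bar>S n x\<bar> < \<eta> * n)"
  proof (rule whp_mono)
    fix n x assume "(S n x)\<^sup>2 < (\<eta> * real n)\<^sup>2"
    then show "\<bar>S n x\<bar> < \<eta> * n"
      using power2_less_imp_less[of "\<bar>S n x\<bar>" "\<eta> * n"] assms by simp
  qed
  then show ?thesis by (simp add: S_def)
qed

lemma whp_count:
  fixes \<eta> :: real
  assumes eta: "\<eta> > 0"
  shows "whp clocks (\<lambda>n x.
     (s2 - s1) / n * card {p \<in> vpairs n. L n p x} - \<eta> * n \<le> card {p \<in> vpairs n. H n p x} \<and>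
     card {p \<in> vpairs n. H n p x} \<le> (s2 - s1) / n * card {p \<in> vpairs n. U n p x} + \<eta> * n)"
proof -
  \<comment> \<open>The tolerance is split in three: the deviation, the early pairs, and the
    quadratic error \<open>(s2 - s1) * s2\<close> of the exponential law, which is below
    \<open>\<eta> / 3 * n\<close> from \<open>n0\<close> on.\<close>
  define n0 where "n0 = nat \<lceil>3 * (s2 - s1) * s2 / \<eta>\<rceil> + 1"
  have "whp clocks (\<lambda>n x. \<bar>real (card {p \<in> vpairs n. H n p x}) - (\<Sum>p\<in>vpairs n. mean n p x)\<bar> < \<eta> / 3 * n
      \<and> \<beta> n * early n x < \<eta> / 3 * n)"
    using eta by (intro whp_conj whp_deviation whp_early) auto
  then show ?thesis
  proof (rule whp_mono[where m = n0])
    fix n x assume n0: "n0 \<le> n" and x: "x \<in> space (clocks n)" and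
      *: "\<bar>real (card {p \<in> vpairs n. H n p x}) - (\<Sum>p\<in>vpairs n. mean n p x)\<bar> < \<eta> / 3 * n
        \<and> \<beta> n * early n x < \<eta> / 3 * n"
    have n: "n \<ge> 1" using n0 by (simp add: n0_def)
    have "3 * (s2 - s1) * s2 / \<eta> \<le> real n" using n0 unfolding n0_def by linarith
    then have big: "(s2 - s1) * s2 \<le> \<eta> / 3 * n" using eta by (simp add: field_simps)
    have "\<mu>I n * card {p \<in> vpairs n. L n p x} - \<beta> n * early n x
        = (\<Sum>p\<in>vpairs n. \<mu>I n * of_bool (L n p x) - \<beta> n * of_bool (\<bar>x (p, 0)\<bar> \<le> K))"
      by (simp add: real_card_Collect early_def sum_subtractf sum_distrib_left)
    also have "\<dots> \<le> (\<Sum>p\<in>vpairs n. mean n p x)"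
      by (intro sum_mono mean_bounds n x)
    finally have lo: "\<mu>I n * card {p \<in> vpairs n. L n p x} - \<beta> n * early n x \<le> (\<Sum>p\<in>vpairs n. mean n p x)" .
    have "(\<Sum>p\<in>vpairs n. mean n p x)
        \<le> (\<Sum>p\<in>vpairs n. \<mu>I n * of_bool (U n p x) + \<beta> n * of_bool (\<bar>x (p, 0)\<bar> \<le> K))"
      by (intro sum_mono mean_bounds n x)
    also have "\<dots> = \<mu>I n * card {p \<in> vpairs n. U n p x} + \<beta> n * early n x"
      by (simp add: real_card_Collect early_def sum.distrib sum_distrib_left)
    also have "\<dots> \<le> (s2 - s1) / n * card {p \<in> vpairs n. U n p x} + \<beta> n * early n x"
      using expo_interval_bounds(1)[OF n s1 s12] by (intro add_right_mono mult_right_mono) (auto simp: \<mu>I_def)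
    finally have hi: "(\<Sum>p\<in>vpairs n. mean n p x) \<le> (s2 - s1) / n * card {p \<in> vpairs n. U n p x} + \<beta> n * early n x" .
    let ?l = "real (card {p \<in> vpairs n. L n p x})"
    have "?l \<le> (real n)\<^sup>2"
      using card_vpairs_le[of n] card_mono[of "vpairs n" "{p \<in> vpairs n. L n p x}"] by fastforce
    then have "(s2 - s1) * s2 / n\<^sup>2 * ?l \<le> (s2 - s1) * s2 / n\<^sup>2 * (real n)\<^sup>2"
      using s1 s12 by (intro mult_left_mono) auto
    also have "\<dots> = (s2 - s1) * s2" using n by simp
    finally have "(s2 - s1) / n * ?l - (s2 - s1) * s2 \<le> ((s2 - s1) / n - (s2 - s1) * s2 / n\<^sup>2) * ?l"
      by (simp add: left_diff_distrib)
    also have "\<dots> \<le> \<mu>I n * ?l"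
      using expo_interval_bounds(2)[OF n s1 s12] by (intro mult_right_mono) (auto simp: \<mu>I_def)
    finally have "(s2 - s1) / n * ?l - \<eta> / 3 * n \<le> \<mu>I n * ?l" using big by linarith
    then show "(s2 - s1) / n * card {p \<in> vpairs n. L n p x} - \<eta> * n \<le> card {p \<in> vpairs n. H n p x} \<and>
     card {p \<in> vpairs n. H n p x} \<le> (s2 - s1) / n * card {p \<in> vpairs n. U n p x} + \<eta> * n"
      using lo hi conjunct1[OF *] conjunct2[OF *] mult_nonneg_nonneg[of \<eta> "real n"] eta
      by (intro conjI) (linarith | simp)+
  qed
qed

end

text \<open>The agreement time must lie strictly beyond \<open>s\<close>, since
  \<open>Gedges\<close> at time \<open>s\<close> includes arrivals at \<open>s\<close> itself; both
  values of the clock exceed \<open>K\<close>, so their minimum works.\<close>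

lemma agree_upd_late:
  assumes "s \<le> K" "0 \<le> K" "K < \<bar>x (p, 0)\<bar>"
  obtains b where "s < b" "agree_below n (arr x) (arr (x((p, 0) := K + 1))) b"
  using assms agree_below_upd'[of "min \<bar>x (p, 0)\<bar> (K + 1)" x p "K + 1" n]
  by (auto intro!: that[of "min \<bar>x (p, 0)\<bar> (K + 1)"])

text \<open>Joined pairs only accumulate in time: an arrival in the interval survives if its pair is
  joined at \<open>s1\<close>, and only if it is joined at \<open>s2\<close>. The horizon is
  \<open>s2\<close> itself.\<close>

lemma whp_survivors_in_interval:
  fixes \<eta> :: real
  assumes s: "0 \<le> s1" "s1 \<le> s2" and eta: "\<eta> > 0"
  shows "whp clocks (\<lambda>n x.
     (s2 - s1) / n * card {p \<in> vpairs n. joined_at n (arr x) k s1 p} - \<eta> * n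
       \<le> card {p \<in> vpairs n. survives n (arr x) k (p, 0) \<and> s1 < \<bar>x (p, 0)\<bar> \<and> \<bar>x (p, 0)\<bar> \<le> s2} \<and>
     card {p \<in> vpairs n. survives n (arr x) k (p, 0) \<and> s1 < \<bar>x (p, 0)\<bar> \<and> \<bar>x (p, 0)\<bar> \<le> s2}
       \<le> (s2 - s1) / n * card {p \<in> vpairs n. joined_at n (arr x) k s2 p} + \<eta> * n)"
proof -
  interpret interval_arrivals s2 s1 s2 "\<lambda>n p x. survives n (arr x) k (p, 0)"
    "\<lambda>n p x. joined_at n (arr x) k s1 p" "\<lambda>n p x. joined_at n (arr x) k s2 p"
  proof
    fix n p q and x :: "edge \<Rightarrow> real" assume "p \<noteq> q" "\<bar>x (p, 0)\<bar> \<le> s2" "\<bar>x (p, 0)\<bar> \<le> \<bar>x (q, 0)\<bar>"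
    then have "agree_below n (arr x) (arr (x((q, 0) := s2 + 1))) \<bar>x (p, 0)\<bar>"
      using s by (intro agree_below_upd') auto
    then show "survives n (arr (x((q, 0) := s2 + 1))) k (p, 0) = survives n (arr x) k (p, 0)"
      using \<open>p \<noteq> q\<close> by (intro survives_cong[symmetric]) auto
  next
    fix n p y and x :: "edge \<Rightarrow> real"
    assume p: "p \<in> vpairs n" and y: "s1 < \<bar>y\<bar>" "\<bar>y\<bar> \<le> s2"
    have agree: "agree_below n (arr (x((p, 0) := y))) (arr (x((p, 0) := s2 + 1))) \<bar>y\<bar>"
      using s y by (intro agree_below_upd) auto
    have surv: "survives n (arr (x((p, 0) := y))) k (p, 0) \<longleftrightarrow> joined_before n (arr (x((p, 0) := y))) k \<bar>y\<bar> p"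
      using survives_iff[of n "arr (x((p, 0) := y))" k "(p, 0)"] vpairs_first[OF p] by simp
    show "survives n (arr (x((p, 0) := y))) k (p, 0)" if "joined_at n (arr (x((p, 0) := s2 + 1))) k s1 p"
      unfolding surv using joined_at_cong[OF agree y(1)] joined_at_imp_before[OF y(1)] that by blast
    show "joined_at n (arr (x((p, 0) := s2 + 1))) k s2 p" if "survives n (arr (x((p, 0) := y))) k (p, 0)"
      using joined_before_cong[OF agree] joined_before_imp_at[OF y(2)] that surv by blast
  next
    fix n p and x :: "edge \<Rightarrow> real" assume late: "s2 < \<bar>x (p, 0)\<bar>"
    have "joined_at n (arr x) k s p = joined_at n (arr (x((p, 0) := s2 + 1))) k s p" if "s \<le> s2" for s
      using agree_upd_late[of s s2 x p n] that late s joined_at_cong by (metis order_trans)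
    then show "joined_at n (arr x) k s1 p \<Longrightarrow> joined_at n (arr (x((p, 0) := s2 + 1))) k s1 p"
      "joined_at n (arr (x((p, 0) := s2 + 1))) k s2 p \<Longrightarrow> joined_at n (arr x) k s2 p"
      using s by simp_all
  qed (use s survives_measurable in auto)
  show ?thesis using whp_count[OF eta] unfolding H_def .
qed

text \<open>The selection \<open>W\<close> is read off the graph at time \<open>s \<le> s1\<close>,
  so clocks ringing after \<open>s1\<close> cannot influence it, and one condition serves as
  \<open>A\<close>, \<open>L\<close> and \<open>U\<close>.\<close>

lemma whp_arrivals_in_selected_pairs:
  fixes \<eta> :: real
  assumes s: "0 \<le> s" "s \<le> s1" "s1 \<le> s2" and eta: "\<eta> > 0"
  shows "whp clocks (\<lambda>n x.
     (s2 - s1) / n * card {p \<in> vpairs n. p \<in> W n (conn_rel n (Gedges n (arr x) k s))} - \<eta> * n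
       \<le> card {p \<in> vpairs n. p \<in> W n (conn_rel n (Gedges n (arr x) k s)) \<and> s1 < \<bar>x (p, 0)\<bar> \<and> \<bar>x (p, 0)\<bar> \<le> s2})"
proof -
  let ?A = "\<lambda>n p x. p \<in> W n (conn_rel n (Gedges n (arr x) k s))"
  interpret interval_arrivals s2 s1 s2 ?A ?A ?A
  proof
    fix n p q and x :: "edge \<Rightarrow> real" assume *: "s1 < \<bar>x (p, 0)\<bar>" "\<bar>x (p, 0)\<bar> \<le> s2" "\<bar>x (p, 0)\<bar> \<le> \<bar>x (q, 0)\<bar>"
    then have "agree_below n (arr x) (arr (x((q, 0) := s2 + 1))) \<bar>x (p, 0)\<bar>"
      using s by (intro agree_below_upd') auto
    then have "Gedges n (arr x) k s = Gedges n (arr (x((q, 0) := s2 + 1))) k s"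
      by (rule Gedges_cong) (use * s in auto)
    then show "?A n p (x((q, 0) := s2 + 1)) = ?A n p x" by simp
  next
    fix n p y and x :: "edge \<Rightarrow> real"
    assume p: "p \<in> vpairs n" and y: "s1 < \<bar>y\<bar>" "\<bar>y\<bar> \<le> s2"
    have "agree_below n (arr (x((p, 0) := y))) (arr (x((p, 0) := s2 + 1))) \<bar>y\<bar>"
      using s y by (intro agree_below_upd) auto
    then have "Gedges n (arr (x((p, 0) := y))) k s = Gedges n (arr (x((p, 0) := s2 + 1))) k s"
      by (rule Gedges_cong) (use y s in auto)
    then show "?A n p (x((p, 0) := s2 + 1)) \<Longrightarrow> ?A n p (x((p, 0) := y))"
      "?A n p (x((p, 0) := y)) \<Longrightarrow> ?A n p (x((p, 0) := s2 + 1))" by simp_all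
  next
    fix n p and x :: "edge \<Rightarrow> real" assume late: "s2 < \<bar>x (p, 0)\<bar>"
    obtain b where "s < b" "agree_below n (arr x) (arr (x((p, 0) := s2 + 1))) b"
      using agree_upd_late[of s s2 x p n] late s by force
    then have "Gedges n (arr x) k s = Gedges n (arr (x((p, 0) := s2 + 1))) k s"
      using Gedges_cong by blast
    then show "?A n p x \<Longrightarrow> ?A n p (x((p, 0) := s2 + 1))"
      "?A n p (x((p, 0) := s2 + 1)) \<Longrightarrow> ?A n p x" by simp_all
  next
    show "Measurable.pred (clocks n) (?A n p)" for n p
      by (rule conn_rel_measurable)
  qed (use s in auto)
  show ?thesis using whp_count[OF eta] unfolding H_def by (rule whp_mono) auto
qed

section \<open>Pairs with several arrivals\<close>

text \<open>Bounding each of the first \<open>r\<close> waiting times by \<open>K\<close> is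
  necessary for \<open>r\<close> arrivals by time \<open>K\<close>, and independence turns its
  probability into an \<open>r\<close>-th power.\<close>

definition repeats :: "real \<Rightarrow> nat \<Rightarrow> nat \<Rightarrow> (edge \<Rightarrow> real) \<Rightarrow> (nat \<times> nat) set" where
  "repeats K n r x = {p \<in> vpairs n. \<forall>l<r. \<bar>x (p, l)\<bar> \<le> K}"

lemma repeats_expectation:
  assumes n: "n \<ge> 1" and K: "0 \<le> K"
  shows "integrable (clocks n) (\<lambda>x. real (card (repeats K n r x)))"
    and "(\<integral>x. real (card (repeats K n r x)) \<partial>clocks n) \<le> (real n)\<^sup>2 * (K / n) ^ r"
proof -
  interpret iid_coordinates "expo n" "all_edges n" using iid_clocks[OF n] .
  let ?S = "\<lambda>p. {x \<in> space P. \<forall>i\<in>(\<lambda>l. (p, l)) ` {..<r}. x i \<in> {y. \<bar>y\<bar> \<le> K}}"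
  have eq: "real (card (repeats K n r x)) = (\<Sum>p\<in>vpairs n. indicator (?S p) x)" if "x \<in> space P" for x
    unfolding repeats_def using that
    by (subst real_card_Collect) (auto intro!: sum.cong simp: indicator_def simp del: sum_of_bool_eq)
  have S: "?S p \<in> sets P" if "p \<in> vpairs n" for p
  proof -
    have "(\<lambda>x. x i) \<in> borel_measurable P" if "i \<in> (\<lambda>l. (p, l)) ` {..<r}" for i
      using measurable_clock[of i n] that vpairs_first[OF \<open>p \<in> vpairs n\<close>] by (auto simp: clocks_def)
    then show ?thesis by (intro sets.sets_Collect_finite_All) (auto intro: measurable_sets_Collect)
  qed
  have intS: "integrable P (indicator (?S p) :: _ \<Rightarrow> real)" if "p \<in> vpairs n" for p
    using S[OF that] by (intro integrable_real_indicator) (auto simp: P.P.emeasure_eq_measure)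
  have "integrable P (\<lambda>x. \<Sum>p\<in>vpairs n. indicator (?S p) x :: real)"
    using intS by (rule Bochner_Integration.integrable_sum)
  then show "integrable (clocks n) (\<lambda>x. real (card (repeats K n r x)))"
    unfolding clocks_def using eq by (subst Bochner_Integration.integrable_cong[OF refl]) auto
  have "(\<integral>x. real (card (repeats K n r x)) \<partial>clocks n) = (\<integral>x. (\<Sum>p\<in>vpairs n. indicator (?S p) x) \<partial>P)"
    unfolding clocks_def using eq by (intro Bochner_Integration.integral_cong) auto
  also have "\<dots> = (\<Sum>p\<in>vpairs n. \<integral>x. indicator (?S p) x \<partial>P)"
    using intS by (rule Bochner_Integration.integral_sum)
  also have "\<dots> = (\<Sum>p\<in>vpairs n. measure (expo n) {y. \<bar>y\<bar> \<le> K} ^ r)"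
  proof (rule sum.cong)
    fix p assume p: "p \<in> vpairs n"
    have "(\<integral>x. indicator (?S p) x \<partial>P) = measure P (?S p)"
      by (simp, intro arg_cong[where f="measure P"], blast)
    also have "\<dots> = measure (expo n) {y. \<bar>y\<bar> \<le> K} ^ card ((\<lambda>l. (p, l)) ` {..<r})"
      using p by (intro prob_coordinates) (auto simp: all_edges_def)
    also have "card ((\<lambda>l. (p, l)) ` {..<r}) = r" by (subst card_image) (auto simp: inj_on_def)
    finally show "(\<integral>x. indicator (?S p) x \<partial>P) = measure (expo n) {y. \<bar>y\<bar> \<le> K} ^ r" .
  qed simp
  also have "\<dots> = real (card (vpairs n)) * measure (expo n) {y. \<bar>y\<bar> \<le> K} ^ r" by simp
  also have "\<dots> \<le> (real n)\<^sup>2 * (K / n) ^ r"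
    using card_vpairs_le expo_early[OF n K] by (intro mult_mono power_mono) auto
  finally show "(\<integral>x. real (card (repeats K n r x)) \<partial>clocks n) \<le> (real n)\<^sup>2 * (K / n) ^ r" .
qed

text \<open>The expected numbers are of order n^(2-r): bounded for second arrivals, and vanishing
  for third ones, so that with high probability there are none of the latter.\<close>

lemma whp_few_repeats:
  fixes \<eta> :: real
  assumes K: "0 \<le> K" and eta: "\<eta> > 0"
  shows "whp clocks (\<lambda>n x. card (repeats K n 2 x) \<le> \<eta> * n \<and> repeats K n 3 x = {})"
proof -
  have "whp clocks (\<lambda>n x. real (card (repeats K n 2 x)) < \<eta> * n)"
  proof (rule whp_Markov[where B="\<lambda>_. K\<^sup>2"])
    show "(\<integral>x. real (card (repeats K n 2 x)) \<partial>clocks n) \<le> K\<^sup>2" if "n \<ge> 1" for n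
      using repeats_expectation(2)[OF that K, of 2] that by (simp add: power_divide)
    show "(\<lambda>n. K\<^sup>2 / (\<eta> * real n)) \<longlonglongrightarrow> 0"
      using tendsto_mult_right_zero[OF lim_1_over_n, of "K\<^sup>2 / \<eta>"] by simp
  qed (use repeats_expectation(1) K eta in auto)
  moreover have "whp clocks (\<lambda>n x. real (card (repeats K n 3 x)) < 1)"
  proof (rule whp_Markov[where B="\<lambda>n. K^3 / n" and b="\<lambda>_. 1"])
    show "(\<integral>x. real (card (repeats K n 3 x)) \<partial>clocks n) \<le> K^3 / n" if "n \<ge> 1" for n
      using repeats_expectation(2)[OF that K, of 3] that
      by (simp add: power_divide power2_eq_square power3_eq_cube)
    show "(\<lambda>n. K^3 / real n / 1) \<longlonglongrightarrow> 0"
      using tendsto_mult_right_zero[OF lim_1_over_n, of "K^3"] by simp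
  qed (use repeats_expectation(1) K in auto)
  ultimately have "whp clocks (\<lambda>n x. real (card (repeats K n 2 x)) < \<eta> * n \<and> real (card (repeats K n 3 x)) < 1)"
    by (rule whp_conj)
  then show ?thesis
    by (rule whp_mono) (auto simp: repeats_def card_eq_0_iff)
qed

lemma countable_all_edges: "countable (all_edges n)"
  by (rule countable_subset[of _ UNIV]) auto

lemma whp_clocks_pos: "whp clocks (\<lambda>n x. \<forall>e\<in>all_edges n. 0 < x e)"
proof (rule whp_AE)
  fix n :: nat assume n: "n \<ge> 1"
  have "AE x in clocks n. 0 < x e" if "e \<in> all_edges n" for e
    unfolding clocks_def by (rule AE_PiM_component[OF _ that AE_expo_pos]) (simp add: prob_space_expo[OF n])
  then show "AE x in clocks n. \<forall>e\<in>all_edges n. 0 < x e"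
    using countable_all_edges by (subst AE_ball_countable) auto
qed

section \<open>Giant components and edge counts\<close>

lemma Gedges_eq_of_arrivals_eq:
  "(\<And>e. e \<in> all_edges n \<Longrightarrow> a e = a' e) \<Longrightarrow> Gedges n a k t = Gedges n a' k t"
  by (rule Gedges_cong[of n a a' "t + 1"]) (auto simp: agree_below_def)

text \<open>Distinct components are disjoint, so once \<open>levelwise_merge\<close> has connected
  them their sizes add up inside a single component.\<close>

lemma C1_after_merge:
  assumes k: "k \<ge> 1" and d: "d > 0" and uv: "u < n" "v < n" "\<not> connected_in (Gedges n a k s) u v"
    and edges: "\<And>j. 1 \<le> j \<Longrightarrow> j \<le> k \<Longrightarrow> \<exists>e\<in>all_edges n.
        s + real (j - 1) * d < a e \<and> a e \<le> s + real j * d \<and>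
        fst e \<in> cross_pairs n (conn_rel n (Gedges n a k s) `` {u}) (conn_rel n (Gedges n a k s) `` {v})"
  shows "card (conn_rel n (Gedges n a k s) `` {u}) + card (conn_rel n (Gedges n a k s) `` {v})
      \<le> C1 n (Gedges n a k (s + real k * d))"
proof -
  let ?G = "Gedges n a k s" and ?G' = "Gedges n a k (s + real k * d)"
  have con: "connected_in ?G' u v"
  proof (rule levelwise_merge[OF k d])
    fix j assume "1 \<le> j" "j \<le> k"
    from edges[OF this] obtain e where "e \<in> all_edges n" "s + real (j - 1) * d < a e" "a e \<le> s + real j * d"
      "fst e \<in> cross_pairs n (conn_rel n ?G `` {u}) (conn_rel n ?G `` {v})"
      by blast
    then show "\<exists>e\<in>all_edges n. s + real (j - 1) * d < a e \<and> a e \<le> s + real j * d \<and>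
        (connected_in ?G u (fst (fst e)) \<and> connected_in ?G v (snd (fst e)) \<or>
         connected_in ?G u (snd (fst e)) \<and> connected_in ?G v (fst (fst e)))"
      by (intro bexI[of _ e]) (auto simp: cross_pairs_def conn_rel_def)
  qed
  have sub: "?G \<subseteq> ?G'" using d by (intro Gedges_mono) simp
  let ?A = "conn_rel n ?G `` {u}" and ?B = "conn_rel n ?G `` {v}"
  have fin: "finite ?A" "finite ?B" "finite (conn_rel n ?G' `` {u})" by simp_all
  have "?A \<inter> ?B = {}"
  proof (rule ccontr)
    assume "?A \<inter> ?B \<noteq> {}"
    then obtain w where "connected_in ?G u w" "connected_in ?G v w" by (auto simp: conn_rel_def)
    then have "connected_in ?G u v" using connected_in_trans connected_in_sym by blast
    with uv show False by blast
  qed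
  then have "card ?A + card ?B = card (?A \<union> ?B)" using fin by (simp add: card_Un_disjoint)
  also have "?A \<union> ?B \<subseteq> conn_rel n ?G' `` {u}"
    using connected_in_mono[OF sub] connected_in_trans[OF con] uv(1) by (auto simp: conn_rel_def)
  then have "card (?A \<union> ?B) \<le> card (conn_rel n ?G' `` {u})" using fin by (intro card_mono)
  also have "\<dots> \<le> C1 n ?G'" by (rule C1_ge[OF uv(1)])
  finally show ?thesis .
qed

section \<open>Excluding a second giant component\<close>

definition second_giant :: "nat \<Rightarrow> real \<Rightarrow> (nat \<times> nat) set \<Rightarrow> nat \<times> nat \<Rightarrow> bool" where
  "second_giant n c R uv \<longleftrightarrow> fst uv < n \<and> snd uv < n \<and> uv \<notin> R \<and>
     (\<forall>w<n. card (R `` {w}) \<le> card (R `` {fst uv})) \<and> c \<le> card (R `` {snd uv})"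

text \<open>The choice depends on the relation \<open>R\<close> alone, so this is a legitimate
  selection \<open>W\<close> for \<open>whp_arrivals_in_selected_pairs\<close>: it does not look at
  later clocks.\<close>

definition giant_pairs :: "nat \<Rightarrow> real \<Rightarrow> (nat \<times> nat) set \<Rightarrow> (nat \<times> nat) set" where
  "giant_pairs n c R = (if \<exists>uv. second_giant n c R uv
     then cross_pairs n (R `` {fst (SOME uv. second_giant n c R uv)}) (R `` {snd (SOME uv. second_giant n c R uv)})
     else {})"

lemma second_giant_absorbed:
  fixes e :: real
  assumes k: "k \<ge> 1" and n: "n \<ge> 1" and d: "d > 0" and e: "e > 0" and s: "0 \<le> s"
    and ex: "second_giant n (e * n) (conn_rel n (Gedges n (arr x) k s)) uv0"
    and arrivals: "\<And>j. 1 \<le> j \<Longrightarrow> j \<le> k \<Longrightarrow>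
      d / n * card {p \<in> vpairs n. p \<in> giant_pairs n (e * n) (conn_rel n (Gedges n (arr x) k s))} - d * e\<^sup>2 / 2 * n
       \<le> card {p \<in> vpairs n. p \<in> giant_pairs n (e * n) (conn_rel n (Gedges n (arr x) k s)) \<and>
            s + real (j - 1) * d < \<bar>x (p, 0)\<bar> \<and> \<bar>x (p, 0)\<bar> \<le> s + real j * d}"
  shows "C1 n (Gedges n (arr x) k s) + e * n \<le> C1 n (Gedges n (arr x) k (s + real k * d))"
proof -
  let ?R = "conn_rel n (Gedges n (arr x) k s)"
  define uv where "uv = (SOME uv. second_giant n (e * n) ?R uv)"
  have uv: "second_giant n (e * n) ?R uv" unfolding uv_def using ex by (rule someI)
  let ?A = "?R `` {fst uv}" and ?B = "?R `` {snd uv}"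
  have W: "giant_pairs n (e * n) ?R = cross_pairs n ?A ?B"
    unfolding giant_pairs_def uv_def by (rule if_P) (use ex in blast)
  have nc: "\<not> connected_in (Gedges n (arr x) k s) (fst uv) (snd uv)"
    using uv by (cases uv) (auto simp: second_giant_def conn_rel_def)
  have B: "e * n \<le> card ?B" and lt: "fst uv < n" "snd uv < n" using uv by (auto simp: second_giant_def)
  have "card ?B \<le> card ?A" using uv by (auto simp: second_giant_def)
  then have A: "e * n \<le> card ?A" using B by linarith
  have "?A \<inter> ?B = {}"
  proof (rule ccontr)
    assume "?A \<inter> ?B \<noteq> {}"
    then obtain w where "connected_in (Gedges n (arr x) k s) (fst uv) w" "connected_in (Gedges n (arr x) k s) (snd uv) w"
      by (auto simp: conn_rel_def)
    then show False using nc connected_in_trans connected_in_sym by blast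
  qed
  then have "card ?A * card ?B \<le> card (cross_pairs n ?A ?B)"
    by (intro card_cross_pairs) (auto simp: conn_rel_def)
  then have "real (card ?A) * real (card ?B) \<le> card (cross_pairs n ?A ?B)"
    by (metis of_nat_le_iff of_nat_mult)
  moreover have "(e * n) * (e * n) \<le> real (card ?A) * real (card ?B)"
    using A B e by (intro mult_mono) auto
  ultimately have "e\<^sup>2 * (real n)\<^sup>2 \<le> card (cross_pairs n ?A ?B)"
    by (simp add: power2_eq_square mult_ac)
  then have "d / n * (e\<^sup>2 * (real n)\<^sup>2) \<le> d / n * card (cross_pairs n ?A ?B)"
    using d by (intro mult_left_mono) auto
  then have big: "d * e\<^sup>2 * n \<le> d / n * card (cross_pairs n ?A ?B)"
    using n by (simp add: power2_eq_square field_simps)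
  \<comment> \<open>At least \<open>e\<^sup>2 * n\<^sup>2\<close> pairs run between the components,
    which makes the main term at least \<open>d * e\<^sup>2 * n\<close>. The tolerance in
    \<open>arrivals\<close> is half of this, so every interval contains an arrival.\<close>
  have pos: "0 < d * e\<^sup>2 * n" using d e n by simp
  have "card ?A + card ?B \<le> C1 n (Gedges n (arr x) k (s + real k * d))"
  proof (rule C1_after_merge[OF k d lt nc])
    fix j assume j: "1 \<le> j" "j \<le> k"
    have eq: "{p \<in> vpairs n. p \<in> cross_pairs n ?A ?B} = cross_pairs n ?A ?B"
      by (auto simp: cross_pairs_def)
    have half: "d * e\<^sup>2 / 2 * n = d * e\<^sup>2 * n / 2" by simp
    have "0 < real (card {p \<in> vpairs n. p \<in> cross_pairs n ?A ?B \<and>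
            s + real (j - 1) * d < \<bar>x (p, 0)\<bar> \<and> \<bar>x (p, 0)\<bar> \<le> s + real j * d})"
      using arrivals[OF j] big pos unfolding W eq half by linarith
    then obtain p where "p \<in> vpairs n" "p \<in> cross_pairs n ?A ?B"
      "s + real (j - 1) * d < \<bar>x (p, 0)\<bar>" "\<bar>x (p, 0)\<bar> \<le> s + real j * d"
      by (auto simp: card_gt_0_iff)
    then show "\<exists>e\<in>all_edges n. s + real (j - 1) * d < arr x e \<and> arr x e \<le> s + real j * d \<and>
        fst e \<in> cross_pairs n ?A ?B"
      by (intro bexI[of _ "(p, 0)"]) (auto intro: vpairs_first)
  qed
  moreover have "C1 n (Gedges n (arr x) k s) \<le> card ?A"
  proof -
    obtain v where "v < n" "card (?R `` {v}) = C1 n (Gedges n (arr x) k s)" using C1_attained[OF n] .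
    then show ?thesis using uv unfolding second_giant_def by metis
  qed
  ultimately show ?thesis using B by linarith
qed

text \<open>After division by n^2 the sum of squared component sizes lies between c^2 and c^2 + e,
  where c = C1/n. Replacing c by \<open>r\<close> costs e/2 because c + r \<le> 2, and the diagonal
  costs 1/n \<le> e; the bound 2e leaves room.\<close>

lemma joined_pairs_estimate:
  fixes e r :: real
  assumes n: "n \<ge> 1" and k: "k \<ge> 1" and e: "e > 0" and big: "1 / e \<le> n" and r: "0 \<le> r" "r \<le> 1"
    and C: "\<bar>C1 n (Gedges n a k s) / n - r\<bar> \<le> e / 4"
    and no: "\<nexists>uv. second_giant n (e * n) (conn_rel n (Gedges n a k s)) uv"
  shows "\<bar>card {p \<in> vpairs n. joined_at n a k s p} / (real n)\<^sup>2 - r\<^sup>2 / 2\<bar> \<le> 2 * e"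
proof -
  let ?G = "Gedges n a k s"
  let ?c = "C1 n ?G / n" and ?R = "real (card (conn_rel n ?G))" and ?Q = "real (card {p \<in> vpairs n. joined_at n a k s p})"
  have np: "real n > 0" using n by simp
  obtain v where v: "v < n" "card (conn_rel n ?G `` {v}) = C1 n ?G" using C1_attained[OF n] .
  have max: "\<forall>w<n. card (conn_rel n ?G `` {w}) \<le> card (conn_rel n ?G `` {v})"
    using v C1_ge by simp
  have "?R \<le> (real (C1 n ?G))\<^sup>2 + (e * n) * n"
  proof (rule conn_rel_le_of_unique_giant[OF v])
    fix w assume w: "w < n" "\<not> connected_in ?G v w"
    then have "\<not> second_giant n (e * n) (conn_rel n ?G) (v, w)" using no by blast
    then show "real (card (conn_rel n ?G `` {w})) \<le> e * n"
      using w v max by (auto simp: second_giant_def conn_rel_def)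
  qed (use e in simp)
  then have "?R / (real n)\<^sup>2 \<le> ((real (C1 n ?G))\<^sup>2 + (e * n) * n) / (real n)\<^sup>2" by (rule divide_right_mono) simp
  also have "\<dots> = ?c\<^sup>2 + e" using np by (simp add: add_divide_distrib power2_eq_square)
  finally have up: "?R / (real n)\<^sup>2 \<le> ?c\<^sup>2 + e" .
  have "real (C1 n ?G * C1 n ?G) \<le> ?R" using C1_square_le[OF n] of_nat_le_iff by blast
  then have "(real (C1 n ?G * C1 n ?G)) / (real n)\<^sup>2 \<le> ?R / (real n)\<^sup>2" by (rule divide_right_mono) simp
  then have lo: "?c\<^sup>2 \<le> ?R / (real n)\<^sup>2" by (simp add: power2_eq_square)
  have c1: "0 \<le> ?c" "?c \<le> 1" using C1_le[OF n, of ?G] np by auto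
  have "\<bar>?c\<^sup>2 - r\<^sup>2\<bar> = \<bar>?c - r\<bar> * \<bar>?c + r\<bar>"
    by (simp add: abs_mult[symmetric] power2_eq_square algebra_simps)
  also have "\<dots> \<le> e / 4 * 2"
    using C c1 r e by (intro mult_mono) auto
  finally have sq: "\<bar>?c\<^sup>2 - r\<^sup>2\<bar> \<le> e / 2" by simp
  have "{p \<in> vpairs n. joined_at n a k s p} = {p \<in> vpairs n. connected_in ?G (fst p) (snd p)}"
    using k by (auto simp: joined_at_def)
  then have "?R = n + 2 * ?Q" using card_conn_rel_vpairs[of n ?G] by simp
  then have "?R / (real n)\<^sup>2 = 1 / n + 2 * (?Q / (real n)\<^sup>2)" using np by (simp add: add_divide_distrib power2_eq_square)
  moreover have "0 \<le> 1 / real n" "1 / real n \<le> e" using big e np by (auto simp: field_simps)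
  ultimately show ?thesis using up lo sq e unfolding of_nat_power abs_le_iff by (intro conjI) linarith+
qed

section \<open>Riemann sums and first arrivals\<close>

text \<open>The mesh is fixed before the tags, because the edge count is compared with the
  left-endpoint and the right-endpoint sums of one and the same partition.\<close>

lemma riemann_sum_approximation:
  fixes f :: "real \<Rightarrow> real"
  assumes t: "0 \<le> t" and cont: "continuous_on {0..t} f" and e: "e > 0"
  obtains m :: nat where "m \<ge> 1" "\<And>\<xi>. (\<And>l. l < m \<Longrightarrow> t / m * l \<le> \<xi> l \<and> \<xi> l \<le> t / m * Suc l) \<Longrightarrow>
     \<bar>t / m * (\<Sum>l<m. f (\<xi> l)) - integral {0..t} f\<bar> \<le> t * e"
proof -
  have "uniformly_continuous_on {0..t} f" using cont by (intro compact_uniformly_continuous) auto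
  then obtain d where d: "d > 0" "\<And>x y. x \<in> {0..t} \<Longrightarrow> y \<in> {0..t} \<Longrightarrow> dist y x < d \<Longrightarrow> dist (f y) (f x) < e"
    using e unfolding uniformly_continuous_on_def by metis
  obtain m :: nat where m: "t / d < m" using reals_Archimedean2 by blast
  have m1: "m \<ge> 1" using m t d(1) by (cases m) (auto simp: divide_less_0_iff not_less[symmetric])
  have td: "t / m < d" using m m1 d(1) by (simp add: field_simps)
  define h where "h = t / m"
  have h: "0 \<le> h" "h * m = t" using t m1 by (auto simp: h_def)
  show thesis
  proof (rule that[OF m1])
    fix \<xi> assume xi: "\<And>l. l < m \<Longrightarrow> t / m * l \<le> \<xi> l \<and> \<xi> l \<le> t / m * Suc l"
    \<comment> \<open>Induction over initial segments: each cell adds an error of at most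
      \<open>h * e\<close> by uniform continuity.\<close>
    have "\<bar>h * (\<Sum>l<j. f (\<xi> l)) - integral {0..h * j} f\<bar> \<le> h * j * e" if "j \<le> m" for j
      using that
    proof (induction j)
      case (Suc j)
      let ?a = "h * j" and ?b = "h * Suc j"
      have bt: "?b \<le> t" using Suc.prems h mult_left_mono[of "real (Suc j)" "real m" h] by simp
      have ab: "0 \<le> ?a" "?a \<le> ?b" using h by (auto simp: algebra_simps)
      have contab: "continuous_on {0..?b} f" "continuous_on {?a..?b} f"
        using continuous_on_subset[OF cont] bt ab by auto
      have split: "integral {0..?a} f + integral {?a..?b} f = integral {0..?b} f"
        using ab contab by (intro Henstock_Kurzweil_Integration.integral_combine integrable_continuous_real) auto
      have "h * f (\<xi> j) - integral {?a..?b} f = integral {?a..?b} (\<lambda>y. f (\<xi> j) - f y)"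
        using ab contab
        by (subst Henstock_Kurzweil_Integration.integral_diff) (auto intro: integrable_continuous_real simp: algebra_simps)
      also have "\<bar>\<dots>\<bar> \<le> e * (?b - ?a)"
      proof -
        have "norm (integral {?a..?b} (\<lambda>y. f (\<xi> j) - f y)) \<le> e * (?b - ?a)"
        proof (rule integral_bound)
          fix y assume y: "y \<in> {?a..?b}"
          have x: "?a \<le> \<xi> j" "\<xi> j \<le> ?b" using xi[of j] Suc.prems by (auto simp: h_def)
          have "\<bar>\<xi> j - y\<bar> \<le> ?b - ?a" using x y by auto
          also have "\<dots> = h" by (simp add: algebra_simps)
          finally have "dist (\<xi> j) y < d" using td by (simp add: dist_real_def h_def)
          then have "dist (f (\<xi> j)) (f y) < e" using x y ab bt by (intro d(2)) auto
          then show "norm (f (\<xi> j) - f y) \<le> e" by (simp add: dist_real_def)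
        qed (use ab contab in \<open>auto intro!: continuous_intros\<close>)
        then show ?thesis by simp
      qed
      finally have "\<bar>h * f (\<xi> j) - integral {?a..?b} f\<bar> \<le> h * e" by (simp add: algebra_simps)
      with Suc split show ?case by (simp add: algebra_simps abs_le_iff)
    qed simp
    from this[of m] show "\<bar>t / m * (\<Sum>l<m. f (\<xi> l)) - integral {0..t} f\<bar> \<le> t * e"
      using h by (simp add: h_def)
  qed
qed

text \<open>Excluding third arrivals leaves at most two edges per pair. It also makes the edge set
  finite, without which \<open>card\<close> would take its default value 0.\<close>

lemma card_Gedges_first_arrivals:
  fixes k :: nat
  assumes pos: "\<And>e. e \<in> all_edges n \<Longrightarrow> 0 < x e" and no3: "repeats t n 3 x = {}"
  defines "F \<equiv> {p \<in> vpairs n. survives n (arr x) k (p, 0) \<and> 0 < \<bar>x (p, 0)\<bar> \<and> \<bar>x (p, 0)\<bar> \<le> t}"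
  shows "finite (Gedges n (arr x) (Suc k) t)"
    and "card F \<le> card (Gedges n (arr x) (Suc k) t)"
    and "card (Gedges n (arr x) (Suc k) t) \<le> card F + card (repeats t n 2 x)"
proof -
  let ?G = "Gedges n (arr x) (Suc k) t"
  let ?F = "(\<lambda>p. (p, 0::nat)) ` F" and ?S = "(\<lambda>p. (p, 1::nat)) ` repeats t n 2 x"
  have finF: "finite F" "finite (repeats t n 2 x)" by (auto simp: F_def repeats_def)
  have sub: "?G \<subseteq> ?F \<union> ?S"
  proof
    fix e assume e: "e \<in> ?G"
    obtain p m where pm: "e = (p, m)" by (cases e)
    have surv: "survives n (arr x) k (p, m)" and le: "arr x (p, m) \<le> t" and p: "p \<in> vpairs n"
      using e pm survives_all_edges[of n "arr x" k e] by (auto simp: Gedges_def all_edges_def)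
    have l: "\<bar>x (p, l)\<bar> \<le> t" if "l \<le> m" for l
      using arr_ge[OF that, of x p] le by linarith
    have "m < 2"
    proof (rule ccontr)
      assume "\<not> m < 2"
      then have "p \<in> repeats t n 3 x" using l p by (auto simp: repeats_def)
      with no3 show False by simp
    qed
    then consider "m = 0" | "m = 1" by linarith
    then show "e \<in> ?F \<union> ?S"
    proof cases
      case 1
      then have "p \<in> F" using surv l p pos[OF vpairs_first[OF p, of 0]] by (auto simp: F_def)
      then show ?thesis using pm 1 by auto
    next
      case 2
      then have "p \<in> repeats t n 2 x" using l p by (auto simp: repeats_def)
      then show ?thesis using pm 2 by auto
    qed
  qed
  then show fin: "finite ?G" using finF finite_subset by blast
  have "card ?G \<le> card (?F \<union> ?S)" using sub finF by (intro card_mono) auto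
  also have "\<dots> \<le> card ?F + card ?S" by (rule card_Un_le)
  also have "\<dots> \<le> card F + card (repeats t n 2 x)"
    using finF by (intro add_mono card_image_le)
  finally show "card ?G \<le> card F + card (repeats t n 2 x)" .
  have "?F \<subseteq> ?G" by (auto simp: F_def Gedges_def)
  then have "card ?F \<le> card ?G" using fin by (intro card_mono)
  moreover have "card ?F = card F" by (rule card_image) (auto simp: inj_on_def)
  ultimately show "card F \<le> card ?G" by simp
qed

lemma card_interval_telescope:
  fixes g :: "nat \<times> nat \<Rightarrow> real"
  assumes "0 \<le> h" and "finite V"
  shows "card {p \<in> V. S p \<and> 0 < g p \<and> g p \<le> h * real m}
      = (\<Sum>l<m. card {p \<in> V. S p \<and> h * real l < g p \<and> g p \<le> h * real (Suc l)})"
proof (induction m)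
  case (Suc m)
  have m: "0 \<le> h * real m" "h * real m \<le> h * real (Suc m)" using assms(1) by (auto simp: algebra_simps)
  have "{p \<in> V. S p \<and> 0 < g p \<and> g p \<le> h * real (Suc m)}
      = {p \<in> V. S p \<and> 0 < g p \<and> g p \<le> h * real m} \<union> {p \<in> V. S p \<and> h * real m < g p \<and> g p \<le> h * real (Suc m)}"
    (is "_ = ?A \<union> ?B")
    using m by auto
  moreover have "card (?A \<union> ?B) = card ?A + card ?B"
    using assms(2) by (intro card_Un_disjoint) auto
  ultimately show ?case using Suc by simp
qed (use assms in \<open>auto simp: not_less[symmetric]\<close>)

section \<open>Convergence at a fixed time\<close>

locale coupled_clocks =
  fixes M :: "nat \<Rightarrow> 'a measure" and V :: "nat \<Rightarrow> 'a \<Rightarrow> edge \<Rightarrow> real" and m :: nat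
  assumes V_meas: "\<And>n. n \<ge> m \<Longrightarrow> V n \<in> M n \<rightarrow>\<^sub>M clocks n"
    and V_distr: "\<And>n. n \<ge> m \<Longrightarrow> distr (M n) (clocks n) (V n) = clocks n"
begin

abbreviation "G n k \<omega> t \<equiv> Gedges n (arr (V n \<omega>)) k t"

definition joined_pairs :: "nat \<Rightarrow> nat \<Rightarrow> 'a \<Rightarrow> real \<Rightarrow> real" where
  "joined_pairs n k \<omega> s = real (card {p \<in> vpairs n. joined_at n (arr (V n \<omega>)) k s p})"

lemma whp_clocks: "whp clocks \<phi> \<Longrightarrow> whp M (\<lambda>n \<omega>. \<phi> n (V n \<omega>))"
  by (rule whp_distr[OF _ V_meas V_distr])

text \<open>If there were a second component of linear size, an edge between it and the largest one would
  arrive in each of \<open>k\<close> short consecutive intervals, which merges them and makes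
  the largest component jump, contradicting the continuity of \<open>\<rho>\<close>.\<close>
lemma whp_joined_pairs:
  fixes \<rho> :: "real \<Rightarrow> real" and \<epsilon> :: real
  assumes k: "k \<ge> 1" and s: "0 \<le> s" and cont: "continuous_on {0..} \<rho>"
    and rho: "\<And>t. 0 \<le> t \<Longrightarrow> 0 \<le> \<rho> t \<and> \<rho> t \<le> 1"
    and C1: "\<And>\<epsilon>. \<epsilon> > 0 \<Longrightarrow> whp M (\<lambda>n \<omega>. \<forall>t\<in>{0..}. \<bar>C1 n (G n k \<omega> t) / n - \<rho> t\<bar> \<le> \<epsilon>)"
    and eps: "\<epsilon> > 0"
  shows "whp M (\<lambda>n \<omega>. \<bar>joined_pairs n k \<omega> s / (real n)\<^sup>2 - (\<rho> s)\<^sup>2 / 2\<bar> \<le> \<epsilon>)"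
proof -
  define e where "e = \<epsilon> / 2"
  have e: "e > 0" using eps by (simp add: e_def)
  obtain d0 where d0: "d0 > 0" "\<And>t. t \<in> {0..} \<Longrightarrow> dist t s < d0 \<Longrightarrow> dist (\<rho> t) (\<rho> s) < e / 4"
    using cont s e unfolding continuous_on_iff by (metis atLeast_iff divide_pos_pos zero_less_numeral)
  \<comment> \<open>The \<open>k\<close> intervals together have length \<open>d0 / 2\<close>, so
    the merging ends within the window where continuity controls \<rho>.\<close>
  define d where "d = d0 / (2 * k)"
  have d: "d > 0" using d0 k by (simp add: d_def)
  have kd: "real k * d = d0 / 2" using k by (simp add: d_def)
  have near: "\<bar>\<rho> (s + real k * d) - \<rho> s\<bar> < e / 4"
    using d0(2)[of "s + real k * d"] d0(1) s unfolding kd by (simp add: dist_real_def)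
  let ?W = "\<lambda>n. giant_pairs n (e * real n)"
  let ?R = "\<lambda>n \<omega>. conn_rel n (G n k \<omega> s)"
  have "whp M (\<lambda>n \<omega>. \<forall>t\<in>{0..}. \<bar>C1 n (G n k \<omega> t) / n - \<rho> t\<bar> \<le> e / 4)"
    using C1[of "e / 4"] e by simp
  moreover have "whp M (\<lambda>n \<omega>. \<forall>j\<in>{1..k}. (s + real j * d - (s + real (j - 1) * d)) / n * card {p \<in> vpairs n. p \<in> ?W n (?R n \<omega>)} - d * e\<^sup>2 / 2 * n
       \<le> card {p \<in> vpairs n. p \<in> ?W n (?R n \<omega>) \<and> s + real (j - 1) * d < \<bar>V n \<omega> (p, 0)\<bar> \<and> \<bar>V n \<omega> (p, 0)\<bar> \<le> s + real j * d})"
  proof (rule whp_finite_ball)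
    fix j assume "j \<in> {1..k}"
    have "s + real (j - 1) * d \<le> s + real j * d" using d by (intro add_left_mono mult_right_mono) auto
    moreover have "0 < d * e\<^sup>2 / 2" "s \<le> s + real (j - 1) * d" using d e by auto
    ultimately show "whp M (\<lambda>n \<omega>. (s + real j * d - (s + real (j - 1) * d)) / n * card {p \<in> vpairs n. p \<in> ?W n (?R n \<omega>)} - d * e\<^sup>2 / 2 * n
       \<le> card {p \<in> vpairs n. p \<in> ?W n (?R n \<omega>) \<and> s + real (j - 1) * d < \<bar>V n \<omega> (p, 0)\<bar> \<and> \<bar>V n \<omega> (p, 0)\<bar> \<le> s + real j * d})"
      using s by (intro whp_clocks whp_arrivals_in_selected_pairs)
  qed simp
  ultimately have "whp M (\<lambda>n \<omega>. (\<forall>t\<in>{0..}. \<bar>C1 n (G n k \<omega> t) / n - \<rho> t\<bar> \<le> e / 4) \<and>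
      (\<forall>j\<in>{1..k}. (s + real j * d - (s + real (j - 1) * d)) / n * card {p \<in> vpairs n. p \<in> ?W n (?R n \<omega>)} - d * e\<^sup>2 / 2 * n
       \<le> card {p \<in> vpairs n. p \<in> ?W n (?R n \<omega>) \<and> s + real (j - 1) * d < \<bar>V n \<omega> (p, 0)\<bar> \<and> \<bar>V n \<omega> (p, 0)\<bar> \<le> s + real j * d}))"
    by (rule whp_conj)
  then show ?thesis
  proof (rule whp_mono[where m="nat \<lceil>1 / e\<rceil> + 1"], elim conjE)
    fix n \<omega> assume n: "nat \<lceil>1 / e\<rceil> + 1 \<le> n" and
      C: "\<forall>t\<in>{0..}. \<bar>C1 n (G n k \<omega> t) / n - \<rho> t\<bar> \<le> e / 4" and
      arr: "\<forall>j\<in>{1..k}. (s + real j * d - (s + real (j - 1) * d)) / n * card {p \<in> vpairs n. p \<in> ?W n (?R n \<omega>)} - d * e\<^sup>2 / 2 * n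
       \<le> card {p \<in> vpairs n. p \<in> ?W n (?R n \<omega>) \<and> s + real (j - 1) * d < \<bar>V n \<omega> (p, 0)\<bar> \<and> \<bar>V n \<omega> (p, 0)\<bar> \<le> s + real j * d}"
    have n1: "n \<ge> 1" "1 / e \<le> n" using n by linarith+
    have "\<nexists>uv. second_giant n (e * n) (?R n \<omega>) uv"
    proof
      assume "\<exists>uv. second_giant n (e * n) (?R n \<omega>) uv"
      then obtain uv where uv: "second_giant n (e * n) (?R n \<omega>) uv" ..
      have "C1 n (G n k \<omega> s) + e * n \<le> C1 n (G n k \<omega> (s + real k * d))"
      proof (rule second_giant_absorbed[OF k n1(1) d e s uv])
        fix j assume j: "1 \<le> j" "j \<le> k"
        have eq: "s + real j * d - (s + real (j - 1) * d) = d"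
          using j by (simp add: of_nat_diff algebra_simps)
        have "j \<in> {1..k}" using j by simp
        from bspec[OF arr this] show "d / n * card {p \<in> vpairs n. p \<in> ?W n (?R n \<omega>)} - d * e\<^sup>2 / 2 * n
          \<le> card {p \<in> vpairs n. p \<in> ?W n (?R n \<omega>) \<and> s + real (j - 1) * d < \<bar>V n \<omega> (p, 0)\<bar> \<and> \<bar>V n \<omega> (p, 0)\<bar> \<le> s + real j * d}"
          unfolding eq .
      qed
      then have "(C1 n (G n k \<omega> s) + e * n) / n \<le> C1 n (G n k \<omega> (s + real k * d)) / n"
        by (rule divide_right_mono) simp
      then have "C1 n (G n k \<omega> s) / n + e \<le> C1 n (G n k \<omega> (s + real k * d)) / n"
        using n1 by (simp add: add_divide_distrib)
      moreover have "\<bar>C1 n (G n k \<omega> s) / n - \<rho> s\<bar> \<le> e / 4"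
        "\<bar>C1 n (G n k \<omega> (s + real k * d)) / n - \<rho> (s + real k * d)\<bar> \<le> e / 4"
        using C s d by auto
      \<comment> \<open>The largest component would gain a fraction \<open>e\<close>, but two
        approximation errors of \<open>e / 4\<close> and a change of \<rho> below
        \<open>e / 4\<close> leave room for less than \<open>3 * e / 4\<close>.\<close>
      ultimately show False using near e unfolding abs_le_iff abs_less_iff by linarith
    qed
    then have "\<bar>joined_pairs n k \<omega> s / (real n)\<^sup>2 - (\<rho> s)\<^sup>2 / 2\<bar> \<le> 2 * e"
      unfolding joined_pairs_def using C s rho[OF s] n1 k e by (intro joined_pairs_estimate) auto
    then show "\<bar>joined_pairs n k \<omega> s / (real n)\<^sup>2 - (\<rho> s)\<^sup>2 / 2\<bar> \<le> \<epsilon>"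
      by (simp add: e_def)
  qed
qed

text \<open>In each grid cell the arrivals are bounded below by the pairs joined at its left end and
  above by those joined at its right end. Both sums approximate the same integral, so no
  monotonicity of \<rho> is needed.\<close>

lemma whp_edges_pointwise:
  fixes \<rho> :: "real \<Rightarrow> real" and \<epsilon> :: real
  assumes t: "0 \<le> t" and cont: "continuous_on {0..t} \<rho>"
    and joined: "\<And>s \<epsilon>. 0 \<le> s \<Longrightarrow> \<epsilon> > 0 \<Longrightarrow>
        whp M (\<lambda>n \<omega>. \<bar>joined_pairs n k \<omega> s / (real n)\<^sup>2 - (\<rho> s)\<^sup>2 / 2\<bar> \<le> \<epsilon>)"
    and eps: "\<epsilon> > 0"
  shows "whp M (\<lambda>n \<omega>. \<bar>card (G n (Suc k) \<omega> t) / n - (1/2) * integral {0..t} (\<lambda>s. (\<rho> s)\<^sup>2)\<bar> \<le> \<epsilon>)"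
proof -
  \<comment> \<open>The factor \<open>t + 1\<close> keeps this meaningful at \<open>t = 0\<close>
    and gives \<open>t * e \<le> \<epsilon> / 4\<close>. Half the Riemann error, the pair counts,
    the \<open>N\<close> deviations and the second arrivals then cost at most 1/8, 1/4, 1/4 and 1/4
    of \<epsilon>.\<close>
  define e where "e = \<epsilon> / (4 * (t + 1))"
  have e: "e > 0" using eps t by (simp add: e_def)
  have te: "t * e \<le> \<epsilon> / 4" using eps t by (simp add: e_def field_simps)
  obtain N :: nat where N: "N \<ge> 1" and riemann: "\<And>\<xi>. (\<And>l. l < N \<Longrightarrow> t / N * l \<le> \<xi> l \<and> \<xi> l \<le> t / N * Suc l) \<Longrightarrow>
     \<bar>t / N * (\<Sum>l<N. (\<rho> (\<xi> l))\<^sup>2) - integral {0..t} (\<lambda>s. (\<rho> s)\<^sup>2)\<bar> \<le> t * e"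
    using riemann_sum_approximation[OF t _ e, of "\<lambda>s. (\<rho> s)\<^sup>2"] cont by (auto intro!: continuous_intros)
  define h where "h = t / N"
  have h: "0 \<le> h" "h * N = t" using t N by (auto simp: h_def)
  define cnt where "cnt n x l = real (card {p \<in> vpairs n. survives n (arr x) k (p, 0) \<and> h * real l < \<bar>x (p, 0)\<bar> \<and> \<bar>x (p, 0)\<bar> \<le> h * real (Suc l)})"
    for n x l
  define \<eta> where "\<eta> = \<epsilon> / (4 * N)"
  have eta: "\<eta> > 0" "N * \<eta> = \<epsilon> / 4" using eps N by (auto simp: \<eta>_def)
  have "whp M (\<lambda>n \<omega>.
     (\<forall>l\<in>{..N}. \<bar>joined_pairs n k \<omega> (h * l) / (real n)\<^sup>2 - (\<rho> (h * l))\<^sup>2 / 2\<bar> \<le> e) \<and>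
     (\<forall>l\<in>{..<N}. (h * real (Suc l) - h * l) / n * joined_pairs n k \<omega> (h * l) - \<eta> * n \<le> cnt n (V n \<omega>) l \<and>
        cnt n (V n \<omega>) l \<le> (h * real (Suc l) - h * l) / n * joined_pairs n k \<omega> (h * real (Suc l)) + \<eta> * n) \<and>
     (card (repeats t n 2 (V n \<omega>)) \<le> \<epsilon> / 4 * n \<and> repeats t n 3 (V n \<omega>) = {}) \<and>
     (\<forall>e\<in>all_edges n. 0 < V n \<omega> e))"
  proof (intro whp_conj whp_finite_ball)
    show "whp M (\<lambda>n \<omega>. \<bar>joined_pairs n k \<omega> (h * l) / (real n)\<^sup>2 - (\<rho> (h * l))\<^sup>2 / 2\<bar> \<le> e)" for l :: nat
      using joined h e by simp
    show "whp M (\<lambda>n \<omega>. (h * real (Suc l) - h * l) / n * joined_pairs n k \<omega> (h * l) - \<eta> * n \<le> cnt n (V n \<omega>) l)" for l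
      unfolding cnt_def joined_pairs_def
      by (rule whp_mono[OF whp_clocks[OF whp_survivors_in_interval[of "h * real l" "h * real (Suc l)" \<eta> k]]])
        (use h eta in \<open>auto intro: mult_left_mono\<close>)
    show "whp M (\<lambda>n \<omega>. cnt n (V n \<omega>) l \<le> (h * real (Suc l) - h * l) / n * joined_pairs n k \<omega> (h * real (Suc l)) + \<eta> * n)" for l
      unfolding cnt_def joined_pairs_def
      by (rule whp_mono[OF whp_clocks[OF whp_survivors_in_interval[of "h * real l" "h * real (Suc l)" \<eta> k]]])
        (use h eta in \<open>auto intro: mult_left_mono\<close>)
    show "whp M (\<lambda>n \<omega>. card (repeats t n 2 (V n \<omega>)) \<le> \<epsilon> / 4 * n)"
      by (rule whp_mono[OF whp_clocks[OF whp_few_repeats[OF t, of "\<epsilon> / 4"]]]) (use eps in auto)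
    show "whp M (\<lambda>n \<omega>. repeats t n 3 (V n \<omega>) = {})"
      by (rule whp_mono[OF whp_clocks[OF whp_few_repeats[OF t, of 1]]]) auto
    show "whp M (\<lambda>n \<omega>. \<forall>e\<in>all_edges n. 0 < V n \<omega> e)"
      by (rule whp_clocks[OF whp_clocks_pos])
  qed auto
  then show ?thesis
  proof (rule whp_mono[where m=1], elim conjE)
    fix n \<omega>
    let ?J = "joined_pairs n k \<omega>" and ?I = "integral {0..t} (\<lambda>s. (\<rho> s)\<^sup>2)"
    assume n: "1 \<le> n"
      and J: "\<forall>l\<in>{..N}. \<bar>?J (h * l) / (real n)\<^sup>2 - (\<rho> (h * l))\<^sup>2 / 2\<bar> \<le> e"
      and cnt: "\<forall>l\<in>{..<N}. (h * real (Suc l) - h * l) / n * ?J (h * l) - \<eta> * n \<le> cnt n (V n \<omega>) l \<and>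
        cnt n (V n \<omega>) l \<le> (h * real (Suc l) - h * l) / n * ?J (h * real (Suc l)) + \<eta> * n"
      and rep: "card (repeats t n 2 (V n \<omega>)) \<le> \<epsilon> / 4 * n" and no3: "repeats t n 3 (V n \<omega>) = {}"
      and pos: "\<forall>e\<in>all_edges n. 0 < V n \<omega> e"
    have np: "real n > 0" using n by simp
    define F where "F = {p \<in> vpairs n. survives n (arr (V n \<omega>)) k (p, 0) \<and> 0 < \<bar>V n \<omega> (p, 0)\<bar> \<and> \<bar>V n \<omega> (p, 0)\<bar> \<le> t}"
    have F: "real (card F) = (\<Sum>l<N. cnt n (V n \<omega>) l)"
      unfolding F_def cnt_def
      using card_interval_telescope[OF h(1), of "vpairs n" "\<lambda>p. survives n (arr (V n \<omega>)) k (p, 0)" "\<lambda>p. \<bar>V n \<omega> (p, 0)\<bar>" N]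
      unfolding h(2) by simp
    have J': "\<bar>?J (h * l) / (real n)\<^sup>2 - (\<rho> (h * l))\<^sup>2 / 2\<bar> \<le> e" if "l \<le> N" for l :: nat
      using J that by auto
    have hh: "h * real (Suc l) - h * l = h" for l by (simp add: algebra_simps)
    have step: "h / n * ?J s = n * (h * (?J s / (real n)\<^sup>2))" for s
      using np by (simp add: power2_eq_square)
    have lo: "n * (h * ((\<rho> (h * l))\<^sup>2 / 2 - e) - \<eta>) \<le> cnt n (V n \<omega>) l" if l: "l < N" for l :: nat
    proof -
      have "n * (h * ((\<rho> (h * l))\<^sup>2 / 2 - e)) \<le> n * (h * (?J (h * l) / (real n)\<^sup>2))"
        using J'[of l] l h np unfolding abs_le_iff by (intro mult_left_mono) auto
      moreover have "n * (h * (?J (h * l) / (real n)\<^sup>2)) - \<eta> * n \<le> cnt n (V n \<omega>) l"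
        using cnt l unfolding hh step by blast
      moreover have "n * (y - \<eta>) = n * y - \<eta> * n" for y :: real by (simp add: algebra_simps)
      ultimately show ?thesis by simp
    qed
    have hi: "cnt n (V n \<omega>) l \<le> n * (h * ((\<rho> (h * Suc l))\<^sup>2 / 2 + e) + \<eta>)" if l: "l < N" for l :: nat
    proof -
      have "n * (h * (?J (h * Suc l) / (real n)\<^sup>2)) \<le> n * (h * ((\<rho> (h * Suc l))\<^sup>2 / 2 + e))"
        using J'[of "Suc l"] l h np unfolding abs_le_iff by (intro mult_left_mono) auto
      moreover have "cnt n (V n \<omega>) l \<le> n * (h * (?J (h * Suc l) / (real n)\<^sup>2)) + \<eta> * n"
        using cnt l unfolding hh step by blast
      moreover have "n * (y + \<eta>) = n * y + \<eta> * n" for y :: real by (simp add: algebra_simps)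
      ultimately show ?thesis by simp
    qed
    have sums: "(\<Sum>l<N. real n * (h * (f l / 2 + c) + c')) = n * (h * (\<Sum>l<N. f l) / 2 + t * c + N * c')"
      for f and c c' :: real
      by (simp add: sum_distrib_left[symmetric] sum.distrib sum_divide_distrib[symmetric] h(2)[symmetric] algebra_simps)
    have "card F \<ge> (\<Sum>l<N. n * (h * ((\<rho> (h * l))\<^sup>2 / 2 + - e) + - \<eta>))"
      unfolding F by (rule sum_mono) (use lo in simp)
    then have F_lo: "card F \<ge> n * (h * (\<Sum>l<N. (\<rho> (h * l))\<^sup>2) / 2 + t * - e + N * - \<eta>)"
      unfolding sums .
    have "card F \<le> (\<Sum>l<N. n * (h * ((\<rho> (h * Suc l))\<^sup>2 / 2 + e) + \<eta>))"
      unfolding F by (rule sum_mono) (use hi in simp)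
    then have F_hi: "card F \<le> n * (h * (\<Sum>l<N. (\<rho> (h * Suc l))\<^sup>2) / 2 + t * e + N * \<eta>)"
      unfolding sums .
    have mono_l: "h * real l \<le> h * real (Suc l)" for l by (rule mult_left_mono[OF _ h(1)]) simp
    have R1: "\<bar>h * (\<Sum>l<N. (\<rho> (h * l))\<^sup>2) - ?I\<bar> \<le> t * e"
      by (rule riemann[folded h_def]) (simp only: order_refl mono_l simp_thms)
    have R2: "\<bar>h * (\<Sum>l<N. (\<rho> (h * Suc l))\<^sup>2) - ?I\<bar> \<le> t * e"
      by (rule riemann[folded h_def]) (simp only: order_refl mono_l simp_thms)
    have "n * ((1/2) * ?I - \<epsilon>) \<le> n * (h * (\<Sum>l<N. (\<rho> (h * l))\<^sup>2) / 2 + t * - e + N * - \<eta>)"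
      using R1 te eta(2) eps np unfolding abs_le_iff by (intro mult_left_mono) auto
    also have "\<dots> \<le> card F" by (rule F_lo)
    also have "\<dots> \<le> real (card (G n (Suc k) \<omega> t))"
      using card_Gedges_first_arrivals(2)[where n=n and x="V n \<omega>" and t=t and k=k] pos no3 by (simp add: F_def)
    finally have 1: "n * ((1/2) * ?I - \<epsilon>) \<le> card (G n (Suc k) \<omega> t)" .
    have "real (card (G n (Suc k) \<omega> t)) \<le> real (card F + card (repeats t n 2 (V n \<omega>)))"
      using card_Gedges_first_arrivals(3)[where n=n and x="V n \<omega>" and t=t and k=k] pos no3 unfolding F_def of_nat_le_iff by simp
    also have "\<dots> \<le> n * (h * (\<Sum>l<N. (\<rho> (h * Suc l))\<^sup>2) / 2 + t * e + N * \<eta>) + \<epsilon> / 4 * n"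
      using F_hi rep by simp
    also have "\<dots> = n * (h * (\<Sum>l<N. (\<rho> (h * Suc l))\<^sup>2) / 2 + t * e + N * \<eta> + \<epsilon> / 4)"
      by (simp add: algebra_simps)
    also have "\<dots> \<le> n * ((1/2) * ?I + \<epsilon>)"
      using R2 te eta(2) np unfolding abs_le_iff by (intro mult_left_mono) auto
    finally have 2: "card (G n (Suc k) \<omega> t) \<le> n * ((1/2) * ?I + \<epsilon>)" .
    show "\<bar>card (G n (Suc k) \<omega> t) / n - (1/2) * ?I\<bar> \<le> \<epsilon>"
      using 1 2 np by (simp add: abs_le_iff field_simps)
  qed
qed

end

section \<open>Transfer to the given clocks and uniformity in time\<close>

lemma exponential_clocks_distr:
  fixes M :: "'a measure" and Y :: "nat \<times> nat \<Rightarrow> nat \<Rightarrow> 'a \<Rightarrow> real"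
  assumes n: "n \<ge> 2" and ps: "prob_space M"
    and indep: "prob_space.indep_vars M (\<lambda>_. borel) (\<lambda>(p, m). Y p m) (all_edges n)"
    and expo: "\<forall>p\<in>vpairs n. \<forall>m. distributed M lborel (Y p m) (exponential_density (1 / real n))"
  defines "V \<equiv> \<lambda>\<omega>. \<lambda>e\<in>all_edges n. Y (fst e) (snd e) \<omega>"
  shows "V \<in> M \<rightarrow>\<^sub>M clocks n" and "distr M (clocks n) V = clocks n"
proof -
  interpret prob_space M by fact
  let ?Y = "\<lambda>e. Y (fst e) (snd e)"
  have ind: "indep_vars (\<lambda>_. borel) ?Y (all_edges n)"
    using indep by (simp add: split_beta')
  have meas: "random_variable borel (?Y e)" if "e \<in> all_edges n" for e
    using ind that by (auto simp: indep_vars_def)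
  have sets: "sets (clocks n) = sets (PiM (all_edges n) (\<lambda>_. borel))"
    unfolding clocks_def by (rule sets_PiM_cong) (auto simp: sets_expo)
  have "V \<in> M \<rightarrow>\<^sub>M PiM (all_edges n) (\<lambda>_. borel)"
    unfolding V_def using meas by (intro measurable_restrict) auto
  then show "V \<in> M \<rightarrow>\<^sub>M clocks n"
    using measurable_cong_sets[OF refl sets] by blast
  \<comment> \<open>The characterisation of independence by a product law requires a nonempty index
    set; this is where \<open>n \<ge> 2\<close> enters.\<close>
  have "((0, 1), 0) \<in> all_edges n" using n by (auto simp: all_edges_def vpairs_def)
  then have ne: "all_edges n \<noteq> {}" by blast
  have "distr M (clocks n) V = distr M (PiM (all_edges n) (\<lambda>_. borel)) V"
    by (rule distr_cong) (auto simp: sets)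
  also have "\<dots> = PiM (all_edges n) (\<lambda>e. distr M borel (?Y e))"
    unfolding V_def using indep_vars_iff_distr_eq_PiM'[OF ne meas] ind by simp
  also have "\<dots> = clocks n"
    unfolding clocks_def
  proof (rule PiM_cong)
    fix e assume "e \<in> all_edges n"
    then have "distributed M lborel (?Y e) (exponential_density (1 / real n))"
      using expo by (auto simp: all_edges_def)
    then have "distr M lborel (?Y e) = expo n"
      by (simp add: distributed_def expo_def)
    moreover have "distr M borel (?Y e) = distr M lborel (?Y e)"
      by (rule distr_cong) auto
    ultimately show "distr M borel (?Y e) = expo n" by simp
  qed simp
  finally show "distr M (clocks n) V = clocks n" .
qed

text \<open>Between neighbouring grid points \<open>f\<close> is trapped by monotonicity while
  \<open>g\<close> moves by at most one mesh width, which adds a second \<open>e\<close> to the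
  error on the grid.\<close>

lemma uniform_of_pointwise_monotone:
  fixes f g :: "real \<Rightarrow> real" and N :: nat
  assumes N: "N \<ge> 1" "T / N \<le> e" and T: "0 \<le> T"
    and f: "\<And>s t. 0 \<le> s \<Longrightarrow> s \<le> t \<Longrightarrow> t \<le> T \<Longrightarrow> f s \<le> f t"
    and g: "\<And>s t. 0 \<le> s \<Longrightarrow> s \<le> t \<Longrightarrow> t \<le> T \<Longrightarrow> g s \<le> g t \<and> g t \<le> g s + (t - s)"
    and grid: "\<And>l. l \<le> N \<Longrightarrow> \<bar>f (T / N * real l) - g (T / N * real l)\<bar> \<le> e"
    and t: "0 \<le> t" "t \<le> T"
  shows "\<bar>f t - g t\<bar> \<le> 2 * e"
proof (cases "T = 0")
  case True
  then have "t = 0" using t by simp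
  then show ?thesis using grid[of 0] by simp
next
  case False
  define h where "h = T / N"
  have h: "h > 0" "h * N = T" using False T N by (auto simp: h_def)
  \<comment> \<open>The cap at \<open>N - 1\<close> handles \<open>t = T\<close>, where the floor
    equals \<open>N\<close> and the cell would leave the interval.\<close>
  define l where "l = min (nat \<lfloor>t / h\<rfloor>) (N - 1)"
  have lN: "Suc l \<le> N" using N by (auto simp: l_def)
  have th: "t / h \<le> N" using t h by (simp add: field_simps)
  have "0 \<le> t / h" using t h by simp
  then have "real l \<le> t / h" unfolding l_def by linarith
  then have lo: "h * l \<le> t" using h by (simp add: field_simps)
  have "t / h \<le> real (Suc l)" unfolding l_def using th N by (cases "nat \<lfloor>t / h\<rfloor> \<le> N - 1") (auto simp: min_def, linarith+)
  then have hi: "t \<le> h * Suc l" using h by (simp add: field_simps)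
  have "h * Suc l \<le> h * N" using lN h by (intro mult_left_mono) auto
  then have top: "h * Suc l \<le> T" using h by simp
  have bot: "0 \<le> h * l" using h by simp
  have "\<bar>f (h * l) - g (h * l)\<bar> \<le> e" "\<bar>f (h * Suc l) - g (h * Suc l)\<bar> \<le> e"
    using grid[of l] grid[of "Suc l"] lN by (auto simp: h_def)
  moreover have "f (h * l) \<le> f t" "f t \<le> f (h * Suc l)"
    using f[OF bot lo t(2)] f[OF t(1) hi top] .
  moreover have "g t \<le> g (h * l) + (t - h * l)" "g (h * Suc l) \<le> g t + (h * Suc l - t)"
    using g[OF bot lo t(2)] g[OF t(1) hi top] by auto
  moreover have "h * Suc l - h * l \<le> e" using N by (simp add: h_def[symmetric] algebra_simps)
  ultimately show ?thesis using lo hi unfolding abs_le_iff by linarith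
qed

context coupled_clocks
begin

lemma whp_edges_uniform:
  fixes \<rho> :: "real \<Rightarrow> real" and \<epsilon> T :: real
  assumes cont: "continuous_on {0..} \<rho>" and rho: "\<And>t. 0 \<le> t \<Longrightarrow> 0 \<le> \<rho> t \<and> \<rho> t \<le> 1"
    and joined: "\<And>s \<epsilon>. 0 \<le> s \<Longrightarrow> \<epsilon> > 0 \<Longrightarrow>
        whp M (\<lambda>n \<omega>. \<bar>joined_pairs n k \<omega> s / (real n)\<^sup>2 - (\<rho> s)\<^sup>2 / 2\<bar> \<le> \<epsilon>)"
    and eps: "\<epsilon> > 0"
  shows "whp M (\<lambda>n \<omega>. \<forall>t\<in>{0..T}. \<bar>card (G n (Suc k) \<omega> t) / n - (1/2) * integral {0..t} (\<lambda>s. (\<rho> s)\<^sup>2)\<bar> \<le> \<epsilon>)"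
proof (cases "0 \<le> T")
  case False
  then show ?thesis by (intro whp_mono[OF whp_True]) auto
next
  case True
  define I where "I t = (1/2) * integral {0..t} (\<lambda>s. (\<rho> s)\<^sup>2)" for t
  \<comment> \<open>Both bounds follow from 0 \<le> \<rho>^2 \<le> 1; the factor 1/2 would even give
    slope 1/2.\<close>
  have I: "I s \<le> I t \<and> I t \<le> I s + (t - s)" if st: "0 \<le> s" "s \<le> t" for s t
  proof -
    have c: "continuous_on {a..b} (\<lambda>s. (\<rho> s)\<^sup>2)" if "0 \<le> a" for a b
      using continuous_on_subset[OF cont, of "{a..b}"] that by (auto intro!: continuous_intros)
    have "integral {0..s} (\<lambda>s. (\<rho> s)\<^sup>2) + integral {s..t} (\<lambda>s. (\<rho> s)\<^sup>2) = integral {0..t} (\<lambda>s. (\<rho> s)\<^sup>2)"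
      using st c by (intro Henstock_Kurzweil_Integration.integral_combine integrable_continuous_real) auto
    moreover have "0 \<le> integral {s..t} (\<lambda>s. (\<rho> s)\<^sup>2)"
      by (rule Henstock_Kurzweil_Integration.integral_nonneg) (use st c in \<open>auto intro: integrable_continuous_real\<close>)
    moreover have "integral {s..t} (\<lambda>s. (\<rho> s)\<^sup>2) \<le> integral {s..t} (\<lambda>_. 1)"
      using st c rho
      by (intro Henstock_Kurzweil_Integration.integral_le integrable_continuous_real) (auto simp: power_le_one)
    ultimately show ?thesis using st by (auto simp: I_def)
  qed
  obtain N0 :: nat where N0: "T / (\<epsilon> / 2) < N0" using reals_Archimedean2 by blast
  define N where "N = Suc N0"
  have N: "N \<ge> 1" "T / N \<le> \<epsilon> / 2" using N0 eps by (auto simp: N_def field_simps)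
  have "whp M (\<lambda>n \<omega>. (\<forall>l\<in>{..N}. \<bar>card (G n (Suc k) \<omega> (T / N * real l)) / n - I (T / N * real l)\<bar> \<le> \<epsilon> / 2) \<and>
      (\<forall>e\<in>all_edges n. 0 < V n \<omega> e) \<and> repeats T n 3 (V n \<omega>) = {})"
  proof (intro whp_conj)
    show "whp M (\<lambda>n \<omega>. \<forall>l\<in>{..N}. \<bar>card (G n (Suc k) \<omega> (T / N * real l)) / n - I (T / N * real l)\<bar> \<le> \<epsilon> / 2)"
      unfolding I_def
    proof (rule whp_finite_ball)
      fix l assume "l \<in> {..N}"
      show "whp M (\<lambda>n \<omega>. \<bar>card (G n (Suc k) \<omega> (T / N * real l)) / n - (1/2) * integral {0..T / N * real l} (\<lambda>s. (\<rho> s)\<^sup>2)\<bar> \<le> \<epsilon> / 2)"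
        by (rule whp_edges_pointwise[OF _ continuous_on_subset[OF cont] joined]) (use True eps in auto)
    qed simp
    show "whp M (\<lambda>n \<omega>. \<forall>e\<in>all_edges n. 0 < V n \<omega> e)" by (rule whp_clocks[OF whp_clocks_pos])
    show "whp M (\<lambda>n \<omega>. repeats T n 3 (V n \<omega>) = {})"
      by (rule whp_mono[OF whp_clocks[OF whp_few_repeats[OF True, of 1]]]) auto
  qed
  then show ?thesis
    unfolding I_def[symmetric]
  proof (rule whp_mono, elim conjE, intro ballI)
    fix n \<omega> t
    assume grid: "\<forall>l\<in>{..N}. \<bar>card (G n (Suc k) \<omega> (T / N * real l)) / n - I (T / N * real l)\<bar> \<le> \<epsilon> / 2"
      and pos: "\<forall>e\<in>all_edges n. 0 < V n \<omega> e" and no3: "repeats T n 3 (V n \<omega>) = {}" and t: "t \<in> {0..T}"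
    \<comment> \<open>Monotonicity of \<open>card\<close> in time needs finiteness at the final
      time, which the absence of third arrivals supplies.\<close>
    have fin: "finite (G n (Suc k) \<omega> T)"
      using card_Gedges_first_arrivals(1)[where n=n and x="V n \<omega>" and t=T and k=k] pos no3 by blast
    have mono: "card (G n (Suc k) \<omega> s) / n \<le> card (G n (Suc k) \<omega> u) / n" if "s \<le> u" "u \<le> T" for s u
    proof -
      have "G n (Suc k) \<omega> s \<subseteq> G n (Suc k) \<omega> u" "G n (Suc k) \<omega> u \<subseteq> G n (Suc k) \<omega> T"
        using that by (auto intro!: Gedges_mono)
      with fin have "card (G n (Suc k) \<omega> s) \<le> card (G n (Suc k) \<omega> u)"
        by (intro card_mono) (auto intro: finite_subset)
      then show ?thesis by (simp add: divide_right_mono)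
    qed
    have "\<bar>card (G n (Suc k) \<omega> t) / n - I t\<bar> \<le> 2 * (\<epsilon> / 2)"
      by (rule uniform_of_pointwise_monotone[OF N True, where f="\<lambda>t. card (G n (Suc k) \<omega> t) / n" and g=I])
        (use mono I grid t in auto)
    then show "\<bar>card (G n (Suc k) \<omega> t) / n - I t\<bar> \<le> \<epsilon>" by simp
  qed
qed

end

text \<open>\<open>\<rho>\<close> belongs to level \<open>k - 1\<close>, since edges enter level
  \<open>k\<close> through pairs joined one level below. For \<open>k = 1\<close> the estimate on
  joined pairs is purely combinatorial.\<close>

theorem theorem2p2:
  fixes M :: "nat \<Rightarrow> 'a measure"
    and X :: "nat \<Rightarrow> nat \<times> nat \<Rightarrow> nat \<Rightarrow> 'a \<Rightarrow> real"
    and k :: nat and T :: real and \<rho> :: "real \<Rightarrow> real"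
  assumes k: "k \<ge> 1"
    and ps: "\<forall>n\<ge>1. prob_space (M n)"
    and indep: "\<forall>n\<ge>1. prob_space.indep_vars (M n) (\<lambda>_. borel) (\<lambda>(p, m). X n p m) (all_edges n)"
    and expo: "\<forall>n\<ge>1. \<forall>p\<in>vpairs n. \<forall>m.
                 distributed (M n) lborel (X n p m) (exponential_density (1 / real n))"
    and rho1: "k = 1 \<Longrightarrow> \<rho> = (\<lambda>_. 1)"
    and rho2: "k \<ge> 2 \<Longrightarrow> continuous_on {0..} \<rho> \<and> (\<forall>t\<ge>0. 0 \<le> \<rho> t \<and> \<rho> t \<le> 1) \<and>
                 sup_to_zero_in_prob M {0..}
                   (\<lambda>n \<omega> t. \<bar>real (C1 n (Gedges n (arrival X n \<omega>) (k - 1) t)) / real n - \<rho> t\<bar>)"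
  shows "sup_to_zero_in_prob M {0..T}
           (\<lambda>n \<omega> t. \<bar>real (card (Gedges n (arrival X n \<omega>) k t)) / real n
                       - (1/2) * integral {0..t} (\<lambda>s. (\<rho> s)\<^sup>2)\<bar>)"
proof -
  define V where "V n \<omega> = (\<lambda>e\<in>all_edges n. X n (fst e) (snd e) \<omega>)" for n \<omega>
  interpret coupled_clocks M V 2
  proof
    fix n :: nat assume n: "2 \<le> n"
    show "V n \<in> M n \<rightarrow>\<^sub>M clocks n" "distr (M n) (clocks n) (V n) = clocks n"
      unfolding V_def using exponential_clocks_distr[OF n, of "M n" "X n"] n ps indep expo by auto
  qed
  \<comment> \<open>On this event the absolute values in \<open>arr\<close> are vacuous, so the
    given process and its canonical version coincide at all levels and times at once.\<close>
  have "whp M (\<lambda>n \<omega>. \<forall>e\<in>all_edges n. 0 < V n \<omega> e)" by (rule whp_clocks[OF whp_clocks_pos])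
  then have same: "whp M (\<lambda>n \<omega>. \<forall>k t. Gedges n (arrival X n \<omega>) k t = G n k \<omega> t)"
  proof (rule whp_mono, intro allI)
    fix n \<omega> k t assume pos: "\<forall>e\<in>all_edges n. 0 < V n \<omega> e"
    show "Gedges n (arrival X n \<omega>) k t = G n k \<omega> t"
    proof (rule Gedges_eq_of_arrivals_eq)
      fix e assume "e \<in> all_edges n"
      then have mem: "(fst e, l) \<in> all_edges n" for l by (auto simp: all_edges_def)
      have "X n (fst e) l \<omega> = \<bar>V n \<omega> (fst e, l)\<bar>" for l
        using bspec[OF pos mem[of l]] mem[of l] by (simp add: V_def)
      then show "arrival X n \<omega> e = arr (V n \<omega>) e" by (simp add: arrival_def arr_def)
    qed
  qed
  have cont: "continuous_on {0..} \<rho>" and rho: "\<And>t. 0 \<le> t \<Longrightarrow> 0 \<le> \<rho> t \<and> \<rho> t \<le> 1"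
    using rho1 rho2 k by (cases "k = 1"; simp)+
  have joined: "whp M (\<lambda>n \<omega>. \<bar>joined_pairs n (k - 1) \<omega> s / (real n)\<^sup>2 - (\<rho> s)\<^sup>2 / 2\<bar> \<le> \<epsilon>)"
    if s: "0 \<le> s" and eps: "\<epsilon> > 0" for s \<epsilon> :: real
  proof (cases "k = 1")
    case True
    show ?thesis
    proof (rule whp_mono[OF whp_True, where m="nat \<lceil>1 / \<epsilon>\<rceil> + 1"])
      fix n \<omega> assume n: "nat \<lceil>1 / \<epsilon>\<rceil> + 1 \<le> n"
      then have np: "real n > 0" "1 / \<epsilon> \<le> n" by linarith+
      \<comment> \<open>At level 0 all n(n-1)/2 pairs count, so the deviation from 1/2 is exactly
        -1/(2n).\<close>
      have "real n * real n = n + 2 * real (card (vpairs n))"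
        using card_vpairs[of n] by (metis of_nat_add of_nat_mult of_nat_numeral)
      then have eq: "joined_pairs n (k - 1) \<omega> s / (real n)\<^sup>2 - (\<rho> s)\<^sup>2 / 2 = - (1 / (2 * n))"
        using True rho1 np by (simp add: joined_pairs_def joined_at_def power2_eq_square field_simps)
      show "\<bar>joined_pairs n (k - 1) \<omega> s / (real n)\<^sup>2 - (\<rho> s)\<^sup>2 / 2\<bar> \<le> \<epsilon>"
        unfolding eq using np eps by (simp add: field_simps)
    qed
  next
    case False
    with k have k2: "k \<ge> 2" by simp
    have "whp M (\<lambda>n \<omega>. \<forall>t\<in>{0..}. \<bar>C1 n (G n (k - 1) \<omega> t) / n - \<rho> t\<bar> \<le> \<epsilon>)" if "\<epsilon> > 0" for \<epsilon>
    proof -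
      have "whp M (\<lambda>n \<omega>. \<forall>t\<in>{0..}. \<bar>C1 n (Gedges n (arrival X n \<omega>) (k - 1) t) / n - \<rho> t\<bar> \<le> \<epsilon>)"
        using rho2[OF k2] that unfolding sup_to_zero_iff_whp by blast
      from whp_conj[OF same this] show ?thesis
        by (rule whp_mono) auto
    qed
    then show ?thesis
      using k2 s cont rho eps by (intro whp_joined_pairs) auto
  qed
  show ?thesis
    unfolding sup_to_zero_iff_whp
  proof (intro allI impI)
    fix \<epsilon> :: real assume eps: "\<epsilon> > 0"
    have "whp M (\<lambda>n \<omega>. \<forall>t\<in>{0..T}. \<bar>card (G n (Suc (k - 1)) \<omega> t) / n - (1/2) * integral {0..t} (\<lambda>s. (\<rho> s)\<^sup>2)\<bar> \<le> \<epsilon>)"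
      by (rule whp_edges_uniform[OF cont]) (fact rho joined eps)+
    from whp_conj[OF same this]
    show "whp M (\<lambda>n \<omega>. \<forall>t\<in>{0..T}. \<bar>real (card (Gedges n (arrival X n \<omega>) k t)) / real n
                       - (1/2) * integral {0..t} (\<lambda>s. (\<rho> s)\<^sup>2)\<bar> \<le> \<epsilon>)"
      by (rule whp_mono) (use k in auto)
  qed
qed

end
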